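(* Every finite modular planar lattice is a Shannon lattice.
   Context: A finite lattice is planar if it has a Hasse diagram drawn in the plane with no crossing edges. A lattice is modular if $a\subseteq b$ implies $a\uplus(x\cap b)=(a\uplus x)\cap b$ for all $x$ (order $\subseteq$, meet $\cap$, join $\uplus$). A polymatroid function on a finite lattice $L$ is $h:L\to\mathbb{R}$ that is non-negative, increasing and submodular ($h(x)+h(y)\ge h(x\uplus y)+h(x\cap y)$). $h$ is entropic if there exist jointly distributed discrete random variables $(X_x)_{x\in L}$ such that for all $x,y$ the variable $X_{x\uplus y}$ and the pair $(X_x,X_y)$ are functions of each other, and $h(x)=H(X_x)$ (Shannon entropy). $L$ is a Shannon lattice if the set of polymatroid functions on $L$ equals the closure in $\mathbb{R}^L$ of the set of entropic functions on $L$. *)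

theory Defs
  imports "HOL-Analysis.Analysis" "HOL-Probability.Probability"
begin

definition covers :: "'a::order \<Rightarrow> 'a \<Rightarrow> bool" where
  "covers a b \<longleftrightarrow> a < b \<and> \<not> (\<exists>c. a < c \<and> c < b)"

definition modular_lattice :: "'a::lattice itself \<Rightarrow> bool" where
  "modular_lattice _ \<longleftrightarrow>
     (\<forall>a b x :: 'a. a \<le> b \<longrightarrow> sup a (inf x b) = inf (sup a x) b)"

definition planar_lattice :: "'a::order itself \<Rightarrow> bool" where
  "planar_lattice _ \<longleftrightarrow>
     (\<exists>pos :: 'a \<Rightarrow> real \<times> real.
        inj pos \<and>
        (\<forall>a b. covers a b \<longrightarrow> snd (pos a) < snd (pos b)) \<and>
        (\<forall>a b c d. covers a b \<longrightarrow> covers c d \<longrightarrow> (a, b) \<noteq> (c, d) \<longrightarrow>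
            closed_segment (pos a) (pos b) \<inter> closed_segment (pos c) (pos d)
              \<subseteq> pos ` ({a, b} \<inter> {c, d})) \<and>
        (\<forall>a b z. covers a b \<longrightarrow> z \<noteq> a \<longrightarrow> z \<noteq> b \<longrightarrow>
            pos z \<notin> closed_segment (pos a) (pos b)))"

definition polymatroid :: "('a::lattice \<Rightarrow> real) \<Rightarrow> bool" where
  "polymatroid h \<longleftrightarrow>
     (\<forall>x. 0 \<le> h x) \<and> (\<forall>x y. x \<le> y \<longrightarrow> h x \<le> h y) \<and>
     (\<forall>x y. h x + h y \<ge> h (sup x y) + h (inf x y))"

definition finite_entropy :: "'b pmf \<Rightarrow> bool" where
  "finite_entropy q \<longleftrightarrow>
     (\<lambda>v. - pmf q v * log 2 (pmf q v)) summable_on set_pmf q"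

definition shannon_entropy :: "'b pmf \<Rightarrow> real" where
  "shannon_entropy q = (\<Sum>\<^sub>\<infinity>v\<in>set_pmf q. - pmf q v * log 2 (pmf q v))"

(* Entropic: a joint distribution p of discrete random variables (X_x)_{x in L}
   (values coded in nat; any countable value set embeds in nat); the sample is
   omega, with X_x = omega x.  X_{x join y} and (X_x, X_y) are (almost surely)
   functions of each other, and h x = H(X_x). *)
definition entropic :: "('a::lattice \<Rightarrow> real) \<Rightarrow> bool" where
  "entropic h \<longleftrightarrow>
     (\<exists>p :: ('a \<Rightarrow> nat) pmf.
        (\<forall>x y. \<exists>f g. \<forall>\<omega>\<in>set_pmf p.
            \<omega> (sup x y) = f (\<omega> x, \<omega> y) \<and> (\<omega> x, \<omega> y) = g (\<omega> (sup x y))) \<and>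
        (\<forall>x. finite_entropy (map_pmf (\<lambda>\<omega>. \<omega> x) p) \<and>
             h x = shannon_entropy (map_pmf (\<lambda>\<omega>. \<omega> x) p)))"

definition shannon_lattice :: "'a::{finite,lattice} itself \<Rightarrow> bool" where
  "shannon_lattice _ \<longleftrightarrow>
     {h :: 'a \<Rightarrow> real. polymatroid h} = closure {h. entropic h}"

end

theory Submission
  imports Defs "HOL-Real_Asymp.Real_Asymp"
begin

text \<open>
  In a plane drawing every maximal chain is the graph of a continuous function of the height, and
  two such graphs can only meet in a common lattice element. So ``left of'' is a well-defined partial order on
  incomparable pairs, and it yields a doubly irreducible element in every sublattice containing both
  bounds (other than the two bounds themselves): the lattice can be dismantled one element \<open>d\<close> at a time.

  Reversing the dismantling, every integer-valued polymatroid \<open>h\<close> on the lattice is represented by rational vector spaces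
  \<open>V x\<close> with \<open>dim (V x) = h x\<close> and \<open>V (sup x y) = V x + V y\<close>. If \<open>lo < d < hi\<close> are the neighbours of
  \<open>d\<close> and \<open>y\<close> is incomparable to \<open>d\<close>, then by modularity \<open>a = inf (sup lo y) hi\<close> is a complement of \<open>d\<close>
  in the interval from \<open>lo\<close> to \<open>hi\<close>. Submodularity at \<open>d\<close> and \<open>a\<close> says that a generic space of dimension \<open>h d\<close> between
  \<open>V lo\<close> and \<open>V hi\<close> together with \<open>V a\<close> generates \<open>V hi\<close>, and this is all that \<open>V d\<close> has to satisfy.

  A random integer vector, uniform on a cube of side \<open>M\<close>, restricted as a linear functional to \<open>V x\<close>
  has entropy \<open>dim (V x) * log 2 M + O(1)\<close>. Making it zero except with probability of order
  \<open>1 / log 2 M\<close> and letting \<open>M\<close> grow shows that every positive multiple of \<open>x \<mapsto> dim (V x)\<close> is a limit of entropic functions.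
\<close>

section \<open>Dismantling lattices with a conjugate order\<close>

text \<open>Conjugate orders in the sense of Dushnik and Miller; one exists exactly when the order
  dimension is at most two. Irreflexivity is the case \<open>x = y\<close> of the first clause, and
  asymmetry then follows by transitivity.\<close>

definition conjugate_order :: "('a::order \<Rightarrow> 'a \<Rightarrow> bool) \<Rightarrow> bool" where
  "conjugate_order R \<longleftrightarrow>
     (\<forall>x y. R x y \<longrightarrow> \<not> x \<le> y \<and> \<not> y \<le> x) \<and>
     (\<forall>x y. \<not> x \<le> y \<longrightarrow> \<not> y \<le> x \<longrightarrow> R x y \<or> R y x) \<and>
     (\<forall>x y z. R x y \<longrightarrow> R y z \<longrightarrow> R x z)"

definition sublattice :: "'a::lattice set \<Rightarrow> bool" where
  "sublattice S \<longleftrightarrow> (\<forall>x\<in>S. \<forall>y\<in>S. sup x y \<in> S \<and> inf x y \<in> S)"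

text \<open>
  The left boundary \<open>C\<close> consists of the \<open>R\<close>-minimal elements. If \<open>c'\<close> follows \<open>c\<close> on it, then \<open>c\<close> meet-reducible
  and \<open>c'\<close> join-reducible are incompatible, so the largest join-irreducible inner element of \<open>C\<close> is doubly irreducible.
\<close>

lemma ex_doubly_irreducible:
  fixes S :: "'a::lattice set" and R :: "'a \<Rightarrow> 'a \<Rightarrow> bool"
  assumes fin: "finite S" and R: "conjugate_order R"
    and b: "b \<in> S" "\<And>x. x \<in> S \<Longrightarrow> b \<le> x" and t: "t \<in> S" "\<And>x. x \<in> S \<Longrightarrow> x \<le> t"
    and ne: "S \<noteq> {b, t}" and sub: "sublattice S"
  obtains d where "d \<in> S" "d \<noteq> b" "d \<noteq> t" "sublattice (S - {d})"
proof -
  have R1: "\<not> x \<le> y" "\<not> y \<le> x" if "R x y" for x y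
    using R that unfolding conjugate_order_def by blast+
  have R2: "R x y \<or> R y x" if "\<not> x \<le> y" "\<not> y \<le> x" for x y
    using R that unfolding conjugate_order_def by blast
  have R3: "R x z" if "R x y" "R y z" for x y z
    using R that unfolding conjugate_order_def by blast
  define C where "C = {c \<in> S. \<forall>w\<in>S. \<not> R w c}"
  have CS: "c \<in> S" if "c \<in> C" for c using that by (simp add: C_def)
  have CR: "\<not> R w c" if "c \<in> C" "w \<in> S" for c w using that by (simp add: C_def)
  have Cch: "x \<le> y \<or> y \<le> x" if "x \<in> C" "y \<in> C" for x y
    using R2[of x y] CR CS that by blast
  have bC: "b \<in> C" using b R1 unfolding C_def by blast
  have tC: "t \<in> C" using t R1 unfolding C_def by blast
  \<comment> \<open>An \<open>R\<close>-minimal element among those left of \<open>z\<close> lies on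
    the boundary, by transitivity.\<close>
  have left: "\<exists>w\<in>C. R w z" if z: "z \<in> S" "z \<notin> C" for z
  proof -
    let ?A = "{w \<in> S. R w z}"
    have "?A \<noteq> {}" using z by (auto simp: C_def)
    moreover have "asymp_on ?A R"
    proof (rule asymp_onI)
      show "\<not> R y x" if "R x y" for x y using R1(1)[of x x] R3[of x y x] that by auto
    qed
    moreover have "transp_on ?A R" by (rule transp_onI) (rule R3)
    ultimately obtain m where m: "m \<in> ?A" "\<forall>x\<in>?A. x \<noteq> m \<longrightarrow> \<not> R x m"
      using Finite_Set.bex_min_element[of ?A R] fin by auto
    have "\<not> R w m" if "w \<in> S" for w using m R3[of w m z] R1(1)[of m m] that by auto
    then have "m \<in> C" using m by (simp add: C_def)
    then show ?thesis using m by auto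
  qed
  define I where "I = C - {b, t}"
  have finI: "finite I" using fin by (simp add: I_def C_def)
  have "I \<noteq> {}"
  proof -
    obtain z where z: "z \<in> S" "z \<noteq> b" "z \<noteq> t" using ne b t by blast
    show ?thesis
    proof (cases "z \<in> C")
      case True then show ?thesis using z by (auto simp: I_def)
    next
      case False
      then obtain w where "w \<in> C" "R w z" using left z by blast
      then show ?thesis using R1[of w z] b(2)[OF z(1)] t(2)[OF z(1)] by (auto simp: I_def)
    qed
  qed
  then obtain c1 where c1: "c1 \<in> I" "\<forall>x\<in>I. x \<le> c1 \<longrightarrow> c1 = x"
    using finite_has_minimal[OF finI] by blast
  have c1C: "c1 \<in> C" "c1 \<noteq> b" "c1 \<noteq> t" using c1 by (auto simp: I_def)
  have c1min: "c1 \<le> x" if "x \<in> I" for x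
    using that c1 Cch[of c1 x] by (auto simp: I_def)
  define JI where "JI c \<longleftrightarrow> (\<forall>x\<in>S-{c}. \<forall>y\<in>S-{c}. sup x y \<noteq> c)" for c
  \<comment> \<open>\<open>c1\<close> is an atom of \<open>S\<close>: an \<open>x\<close> strictly
    between \<open>b\<close> and \<open>c1\<close> would be off the boundary, and a boundary element
    to its left would be above \<open>c1\<close>, hence above \<open>x\<close>. So
    \<open>JI c1\<close> holds, and the maximum taken below is over a non-empty set.\<close>
  have atom: "x = b \<or> x = c1" if xS: "x \<in> S" and "x \<le> c1" for x
  proof (rule ccontr)
    assume n: "\<not> ?thesis"
    then have lt: "x < c1" "x \<noteq> b" using that by auto
    have "x \<notin> C" using c1min[of x] lt t(2)[OF CS[OF c1C(1)]] by (auto simp: I_def dest: leD)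
    then obtain w where w: "w \<in> C" "R w x" using left xS by blast
    then have "w \<in> I" using R1[of w x] b(2)[OF xS] t(2)[OF xS] by (auto simp: I_def)
    then show False using c1min[of w] lt R1[OF w(2)] by (meson less_imp_le order_trans)
  qed
  have "JI c1" unfolding JI_def
  proof (intro ballI notI)
    fix x y assume "x \<in> S - {c1}" "y \<in> S - {c1}" "sup x y = c1"
    then have "x = b" "y = b" using atom[of x] atom[of y] by auto
    then show False using \<open>sup x y = c1\<close> c1C by simp
  qed
  then have "{c \<in> I. JI c} \<noteq> {}" "finite {c \<in> I. JI c}" using c1 finI by auto
  then obtain c where c: "c \<in> I" "JI c" and cmax: "\<And>x. x \<in> I \<Longrightarrow> JI x \<Longrightarrow> c \<le> x \<Longrightarrow> c = x"
    using finite_has_maximal[of "{c \<in> I. JI c}"] by blast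
  have cC: "c \<in> C" "c \<noteq> b" "c \<noteq> t" "c \<in> S" using c CS by (auto simp: I_def)
  have MI: "inf p q \<noteq> c" if pq: "p \<in> S - {c}" "q \<in> S - {c}" for p q
  proof
    assume e: "inf p q = c"
    let ?N = "{x \<in> C. c < x}"
    have "t \<in> ?N" using tC cC t by (auto simp: less_le)
    moreover have "finite ?N" using fin by (simp add: C_def)
    ultimately obtain c' where c': "c' \<in> ?N" and c'm: "\<forall>x\<in>?N. x \<le> c' \<longrightarrow> c' = x"
      using finite_has_minimal[of ?N] by blast
    have c'C: "c' \<in> C" "c < c'" "c' \<in> S" using c' CS by auto
    have c'min: "c' \<le> x" if "x \<in> C" "c < x" for x
      using c'm Cch[of c' x] c' that by auto
    \<comment> \<open>\<open>c'\<close> covers \<open>c\<close> in all of \<open>S\<close>, not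
      merely in \<open>C\<close>: a boundary element left of an intermediate \<open>z\<close> is not
      below \<open>c\<close>, so it is above \<open>c'\<close> and thus comparable with
      \<open>z\<close>.\<close>
    have cov: "z = c'" if z: "z \<in> S" "c < z" "z \<le> c'" for z
    proof (rule ccontr)
      assume "z \<noteq> c'"
      then have zl: "z < c'" using z by auto
      then have "z \<notin> C" using c'min z by (meson leD)
      then obtain w where w: "w \<in> C" "R w z" using left z by blast
      have "\<not> w \<le> c" using R1[OF w(2)] z by (meson less_imp_le order_trans)
      then have "c < w" using Cch[OF w(1) cC(1)] by auto
      then have "c' \<le> w" using c'min w by blast
      then show False using R1[OF w(2)] zl by (meson less_imp_le order_trans)
    qed
    have "\<not> c' \<le> p \<or> \<not> c' \<le> q" using e c'C by (metis le_inf_iff leD)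
    then obtain z where z: "z \<in> S" "z \<noteq> c" "c \<le> z" "\<not> c' \<le> z"
      using pq e by (metis DiffE inf_le1 inf_le2 singletonI)
    have cz: "c < z" using z by auto
    have "\<not> z \<le> c'" using cov[OF z(1) cz] z by auto
    then have Rz: "R c' z" using R2[of c' z] z CR[OF c'C(1) z(1)] by blast
    have "c' \<noteq> t" using z t \<open>\<not> z \<le> c'\<close> by auto
    moreover have "c' \<noteq> b" using c'C b cC by (metis leD)
    ultimately have "c' \<in> I" using c'C by (auto simp: I_def)
    then have "\<not> JI c'" using cmax[of c'] c'C(2) by (auto simp: less_le)
    then obtain u v where uv: "u \<in> S - {c'}" "v \<in> S - {c'}" "sup u v = c'" by (auto simp: JI_def)
    then have "\<not> u \<le> c \<or> \<not> v \<le> c" using c'C by (metis le_sup_iff leD)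
    then obtain y where y: "y \<in> S" "y \<noteq> c'" "y \<le> c'" "\<not> y \<le> c"
      using uv by (metis DiffE sup_ge1 sup_ge2 singletonI)
    have "\<not> c \<le> y" using cov[OF y(1)] y by (auto simp: less_le)
    then have Ry: "R c y" using R2[of c y] y CR[OF cC(1) y(1)] by blast
    have "\<not> y \<le> z"
    proof
      assume "y \<le> z"
      then have yl: "y \<le> inf z c'" using y by simp
      have "inf z c' = c' \<or> inf z c' = c"
        using cov[of "inf z c'"] sub z(1) c'C z(3) unfolding sublattice_def
        by (metis inf.cobounded2 inf_greatest less_imp_le order_le_imp_less_or_eq)
      then show False using yl y z by (metis inf_le1)
    qed
    moreover have "\<not> z \<le> y" using \<open>\<not> c \<le> y\<close> z by (meson order_trans)
    ultimately have "R y z \<or> R z y" using R2 by blast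
    \<comment> \<open>\<open>R y z\<close> would put \<open>c\<close> left of \<open>z\<close>
      although \<open>c \<le> z\<close>; \<open>R z y\<close> would put \<open>c'\<close> left of
      \<open>y\<close> although \<open>y \<le> c'\<close>.\<close>
    then show False using R3[OF Ry, of z] R3[OF Rz, of y] R1 z y by blast
  qed
  show thesis
    using that[OF cC(4,2,3)] sub MI c(2) unfolding sublattice_def JI_def by auto
qed

section \<open>Planar drawings\<close>

text \<open>The base case is a covering pair rather than a point, so that every height between the
  two ends lies on an edge of the drawn chain.\<close>

inductive saturated_chain :: "'a::order set \<Rightarrow> 'a \<Rightarrow> 'a \<Rightarrow> bool" where
  base: "covers a b \<Longrightarrow> saturated_chain {a, b} a b"
| step: "saturated_chain C a b \<Longrightarrow> covers b d \<Longrightarrow> saturated_chain (insert d C) a d"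

lemma saturated_chain_ends:
  "saturated_chain C a b \<Longrightarrow> a \<in> C \<and> b \<in> C \<and> a < b"
  by (induction rule: saturated_chain.induct) (auto simp: covers_def)

lemma saturated_chain_bounds:
  "saturated_chain C a b \<Longrightarrow> x \<in> C \<Longrightarrow> a \<le> x \<and> x \<le> b"
proof (induction rule: saturated_chain.induct)
  case (step C a b d)
  then show ?case using saturated_chain_ends[OF step(1)] by (auto simp: covers_def)
qed (auto simp: covers_def)

lemma saturated_chain_total:
  "saturated_chain C a b \<Longrightarrow> x \<in> C \<Longrightarrow> y \<in> C \<Longrightarrow> x \<le> y \<or> y \<le> x"
proof (induction rule: saturated_chain.induct)
  case (step C a b d)
  then show ?case using saturated_chain_bounds[OF step(1)] by (fastforce simp: covers_def)
qed (auto simp: covers_def)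

lemma saturated_chain_Un:
  "saturated_chain D b d \<Longrightarrow> saturated_chain C a b \<Longrightarrow> saturated_chain (C \<union> D) a d"
proof (induction rule: saturated_chain.induct)
  case (base b d)
  have "C \<union> {b, d} = insert d C" using saturated_chain_ends[OF base(2)] by auto
  then show ?case using saturated_chain.step[OF base(2,1)] by simp
next
  case (step D b d e)
  then show ?case using saturated_chain.step[of "C \<union> D" a d e] by simp
qed

lemma ex_saturated_chain:
  fixes a b :: "'a::{finite,order}"
  shows "a < b \<Longrightarrow> \<exists>C. saturated_chain C a b"
proof (induction "card {z. z < b}" arbitrary: b rule: less_induct)
  case less
  have "finite {z. a \<le> z \<and> z < b}" "{z. a \<le> z \<and> z < b} \<noteq> {}" using less.prems by auto
  then obtain c where c: "a \<le> c" "c < b" and cm: "\<And>z. a \<le> z \<Longrightarrow> z < b \<Longrightarrow> c \<le> z \<Longrightarrow> c = z"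
    using finite_has_maximal[of "{z. a \<le> z \<and> z < b}"] by auto
  have cov: "covers c b" unfolding covers_def
    using c cm by (metis less_le order_trans)
  show ?case
  proof (cases "a = c")
    case True then show ?thesis using cov base by blast
  next
    case False
    have "{z. z < c} \<subset> {z. z < b}" using c by auto
    then have "card {z. z < c} < card {z. z < b}" by (simp add: psubset_card_mono)
    then obtain C where "saturated_chain C a c" using less.hyps[of c] False c by (auto simp: less_le)
    then show ?thesis using step cov by blast
  qed
qed

lemma ex_saturated_chain_through:
  fixes x y :: "'a::{finite,order}"
  assumes "x \<le> y" and b: "\<And>x. b \<le> x" and t: "\<And>x. x \<le> t" and "b \<noteq> t"
  shows "\<exists>C. saturated_chain C b t \<and> x \<in> C \<and> y \<in> C"
proof -
  \<comment> \<open>Saturated chains have at least one edge; the pair \<open>A = {}\<close>,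
    \<open>b = u\<close> stands for the chain of length zero.\<close>
  have ext: "\<exists>C. saturated_chain C b v \<and> insert u A \<subseteq> C"
    if "saturated_chain A b u \<or> (A = {} \<and> b = u)" and uv: "u \<le> v" "b \<noteq> v" for A u v
  proof (cases "u = v")
    case True
    then show ?thesis using that uv saturated_chain_ends by (metis insert_absorb order_refl)
  next
    case False
    then obtain D where D: "saturated_chain D u v" using ex_saturated_chain uv by (metis less_le)
    then have "u \<in> D" using saturated_chain_ends by blast
    then show ?thesis using that D saturated_chain_Un by (metis Un_iff empty_subsetI insert_subset subset_refl sup_ge1)
  qed
  have 1: "\<exists>A. (saturated_chain A b x \<or> (A = {} \<and> b = x))"
    using ex_saturated_chain b by (metis less_le)
  then obtain A where A: "saturated_chain A b x \<or> (A = {} \<and> b = x)" by blast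
  have "\<exists>A. (saturated_chain A b y \<or> (A = {} \<and> b = y)) \<and> x \<in> insert y A"
    using ext[OF A assms(1)] A b assms(1) by (metis antisym insertI1 insertI2 insert_subset)
  then obtain A' where A': "saturated_chain A' b y \<or> (A' = {} \<and> b = y)" "x \<in> insert y A'" by blast
  show ?thesis using ext[OF A'(1) t \<open>b \<noteq> t\<close>] A'(2) by blast
qed

section \<open>Maximal chains as curves over the height\<close>

text \<open>Intermediate value theorem for \<open>g - f\<close>.\<close>

lemma sign_constant:
  fixes f g :: "real \<Rightarrow> real"
  assumes "continuous_on {l..u} f" "continuous_on {l..u} g" "\<And>s. s \<in> {l..u} \<Longrightarrow> f s \<noteq> g s"
    and "r \<in> {l..u}" "s \<in> {l..u}" "f r < g r"
  shows "f s < g s"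
proof (rule ccontr)
  assume n: "\<not> f s < g s"
  have "connected ((\<lambda>s. g s - f s) ` {l..u})"
    by (intro connected_continuous_image continuous_intros assms connected_Icc)
  moreover have "g r - f r \<in> (\<lambda>s. g s - f s) ` {l..u}" "g s - f s \<in> (\<lambda>s. g s - f s) ` {l..u}"
    using assms by auto
  ultimately have "0 \<in> (\<lambda>s. g s - f s) ` {l..u}"
    using n assms(6) connectedD_interval[of _ "g s - f s" "g r - f r" 0] by auto
  then show False using assms(3) by force
qed

text \<open>The bounds are distinct so that a chain with at least one edge joins them; the
  one-element lattice is treated apart.\<close>

locale planar_drawing =
  fixes pos :: "'a::{finite,lattice} \<Rightarrow> real \<times> real" and b t :: 'a
  assumes up: "covers x y \<Longrightarrow> snd (pos x) < snd (pos y)"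
    and noncrossing: "\<lbrakk>covers x y; covers u v; (x, y) \<noteq> (u, v)\<rbrakk> \<Longrightarrow>
      closed_segment (pos x) (pos y) \<inter> closed_segment (pos u) (pos v) \<subseteq> pos ` ({x, y} \<inter> {u, v})"
    and least: "b \<le> x" and greatest: "x \<le> t" and nontrivial: "b \<noteq> t"
begin

abbreviation "hx x \<equiv> fst (pos x)"
abbreviation "hy x \<equiv> snd (pos x)"

lemma hy_strict_mono: "x < y \<Longrightarrow> hy x < hy y"
proof -
  assume "x < y"
  then obtain C where "saturated_chain C x y" using ex_saturated_chain by blast
  then show ?thesis by (induction rule: saturated_chain.induct) (use up in force)+
qed

lemma hy_mono: "x \<le> y \<Longrightarrow> hy x \<le> hy y"
  using hy_strict_mono[of x y] by (auto simp: le_less)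

text \<open>The function \<open>c\<close> gives the horizontal coordinate of the polygonal chain \<open>C\<close> at each height.\<close>

definition drawn_chain :: "'a set \<Rightarrow> (real \<Rightarrow> real) \<Rightarrow> bool" where
  "drawn_chain C c \<longleftrightarrow> saturated_chain C b t \<and> continuous_on {hy b..hy t} c \<and>
     (\<forall>v\<in>C. c (hy v) = hx v) \<and>
     (\<forall>s\<in>{hy b..hy t}. \<exists>u\<in>C. \<exists>v\<in>C. covers u v \<and> (c s, s) \<in> closed_segment (pos u) (pos v))"

lemma segment_point:
  assumes "hy u < hy v" "hy u \<le> s" "s \<le> hy v"
  shows "(hx u + (s - hy u) / (hy v - hy u) * (hx v - hx u), s) \<in> closed_segment (pos u) (pos v)"
proof -
  let ?r = "(s - hy u) / (hy v - hy u)"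
  have "0 \<le> ?r" "?r \<le> 1" using assms by auto
  moreover have lin: "p + ?r * (q - p) = (1 - ?r) * p + ?r * q" for p q
    by (simp add: left_diff_distrib right_diff_distrib)
  moreover have "(hx u + ?r * (hx v - hx u), s) = (1 - ?r) *\<^sub>R pos u + ?r *\<^sub>R pos v"
  proof (rule prod_eqI)
    have "s = hy u + ?r * (hy v - hy u)" using assms by simp
    then show "snd (hx u + ?r * (hx v - hx u), s) = snd ((1 - ?r) *\<^sub>R pos u + ?r *\<^sub>R pos v)"
      unfolding lin by simp
  qed (simp only: lin fst_conv fst_add fst_scaleR real_scaleR_def)
  ultimately show ?thesis unfolding in_segment by blast
qed

text \<open>Heights increase strictly along a chain, so its edges occupy consecutive height
  intervals and their affine parametrisations glue to one continuous function.\<close>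

lemma saturated_chain_curve:
  "saturated_chain C a d \<Longrightarrow> \<exists>c. continuous_on {hy a..hy d} c \<and> (\<forall>v\<in>C. c (hy v) = hx v) \<and>
     (\<forall>s\<in>{hy a..hy d}. \<exists>u\<in>C. \<exists>v\<in>C. covers u v \<and> (c s, s) \<in> closed_segment (pos u) (pos v))"
proof (induction rule: saturated_chain.induct)
  case (base a b)
  define c where "c s = hx a + (s - hy a) / (hy b - hy a) * (hx b - hx a)" for s
  have "continuous_on {hy a..hy b} c"
    unfolding c_def using up[OF base] by (intro continuous_intros) auto
  moreover have "c (hy a) = hx a" "c (hy b) = hx b" using up[OF base] by (auto simp: c_def)
  moreover have "(c s, s) \<in> closed_segment (pos a) (pos b)" if "s \<in> {hy a..hy b}" for s
    unfolding c_def using segment_point up[OF base] that by auto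
  ultimately show ?case using base by blast
next
  case (step C a b d)
  then obtain c where c: "continuous_on {hy a..hy b} c" "\<And>v. v \<in> C \<Longrightarrow> c (hy v) = hx v"
    "\<And>s. s \<in> {hy a..hy b} \<Longrightarrow> \<exists>u\<in>C. \<exists>v\<in>C. covers u v \<and> (c s, s) \<in> closed_segment (pos u) (pos v)"
    by blast
  define g where "g s = hx b + (s - hy b) / (hy d - hy b) * (hx d - hx b)" for s
  define f where "f s = (if s \<le> hy b then c s else g s)" for s
  have bC: "b \<in> C" "a < b" using saturated_chain_ends[OF step(1)] by auto
  have ab: "hy a < hy b" "hy b < hy d" using hy_strict_mono bC up[OF step(2)] by auto
  have g: "continuous_on {hy b..hy d} g"
    unfolding g_def using ab by (intro continuous_intros) auto
  have "c (hy b) = g (hy b)" using c(2)[OF bC(1)] by (simp add: g_def)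
  then have "x = hy b \<Longrightarrow> c x = g x" for x by simp
  \<comment> \<open>The two pieces overlap only at height \<open>hy b\<close>; gluing requires
    agreement there.\<close>
  then have eq: "\<forall>x. x \<in> {hy a..hy b} \<and> \<not> x \<le> hy b \<or> x \<in> {hy b..hy d} \<and> x \<le> hy b \<longrightarrow> c x = g x"
    by (metis atLeastAtMost_iff order_antisym_conv)
  have "continuous_on ({hy a..hy b} \<union> {hy b..hy d}) f"
    unfolding f_def by (rule continuous_on_cases[OF closed_atLeastAtMost closed_atLeastAtMost c(1) g eq])
  moreover have "{hy a..hy b} \<union> {hy b..hy d} = {hy a..hy d}" using ab by auto
  ultimately have f1: "continuous_on {hy a..hy d} f" by simp
  have f2: "f (hy v) = hx v" if "v \<in> insert d C" for v
  proof (cases "v \<in> C")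
    case True
    then have "hy v \<le> hy b" using hy_mono saturated_chain_bounds[OF step(1)] by blast
    then show ?thesis using c(2)[OF True] by (simp add: f_def)
  next
    case False then show ?thesis using that ab by (auto simp: f_def g_def)
  qed
  have f3: "\<exists>u\<in>insert d C. \<exists>v\<in>insert d C. covers u v \<and> (f s, s) \<in> closed_segment (pos u) (pos v)"
    if s: "s \<in> {hy a..hy d}" for s
  proof (cases "s \<le> hy b")
    case True
    then show ?thesis using c(3)[of s] s by (auto simp: f_def)
  next
    case False
    then have "(f s, s) \<in> closed_segment (pos b) (pos d)"
      using segment_point[of b d s] ab s by (auto simp: f_def g_def)
    then show ?thesis using bC step(2) by blast
  qed
  show ?case using f1 f2 f3 by (intro exI[of _ f] conjI ballI)
qed

lemma ex_drawn_chain_through: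
  assumes "x \<le> y"
  obtains C c where "drawn_chain C c" "x \<in> C" "y \<in> C"
  using ex_saturated_chain_through[OF assms least greatest nontrivial] saturated_chain_curve
  unfolding drawn_chain_def by metis

lemma segment_height:
  assumes "covers u v" "(r, s) \<in> closed_segment (pos u) (pos v)"
  shows "hy u \<le> s" "s \<le> hy v"
proof -
  obtain k where k: "0 \<le> k" "k \<le> 1" "(r, s) = (1 - k) *\<^sub>R pos u + k *\<^sub>R pos v"
    using assms(2) unfolding in_segment by blast
  then have s: "s = (1 - k) * hy u + k * hy v" by (metis snd_conv snd_add snd_scaleR real_scaleR_def)
  have "s = hy u + k * (hy v - hy u)" "s = hy v - (1 - k) * (hy v - hy u)"
    unfolding s by (simp_all add: algebra_simps)
  moreover have "0 \<le> k * (hy v - hy u)" "0 \<le> (1 - k) * (hy v - hy u)"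
    using k up[OF assms(1)] by (auto intro: mult_nonneg_nonneg)
  ultimately show "hy u \<le> s" "s \<le> hy v" by linarith+
qed

text \<open>The meeting point lies on an edge of each chain. If the edges differ, it is the image of
  an element \<open>z\<close> of both chains, and \<open>y \<le> z \<le> x\<close>. If they
  coincide, the ends of the edge belong to both chains and link \<open>y\<close> to
  \<open>x\<close>.\<close>

lemma drawn_chain_meet:
  assumes C: "drawn_chain C c" "y \<in> C" and E: "drawn_chain E e" "x \<in> E"
    and s: "hy y \<le> s" "s \<le> hy x" "c s = e s"
  shows "y \<le> x"
proof -
  have "s \<in> {hy b..hy t}" using s hy_mono[OF least, of y] hy_mono[OF greatest, of x] by auto
  then obtain u v u' v' where uv: "u \<in> C" "v \<in> C" "covers u v" "(c s, s) \<in> closed_segment (pos u) (pos v)"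
    and uv': "u' \<in> E" "v' \<in> E" "covers u' v'" "(e s, s) \<in> closed_segment (pos u') (pos v')"
    using C(1) E(1) unfolding drawn_chain_def by meson
  have Cs: "saturated_chain C b t" and Es: "saturated_chain E b t"
    using C E by (auto simp: drawn_chain_def)
  have below: "z \<le> x" if "z \<in> E" "hy z \<le> hy x" for z
    using saturated_chain_total[OF Es that(1) E(2)] that(2) hy_strict_mono[of x z] by fastforce
  have above: "y \<le> z" if "z \<in> C" "hy y \<le> hy z" for z
    using saturated_chain_total[OF Cs that(1) C(2)] that(2) hy_strict_mono[of z y] by fastforce
  show ?thesis
  proof (cases "(u, v) = (u', v')")
    case True
    have hs: "hy u \<le> s" "s \<le> hy v" using segment_height uv by auto
    have "u \<le> x" using below uv' True hs s by auto
    have "y \<le> v" using above uv hs s by auto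
    \<comment> \<open>\<open>y\<close> and \<open>u\<close> are comparable in the chain
      \<open>C\<close>, and nothing lies strictly between \<open>u\<close> and
      \<open>v\<close>.\<close>
    have "y \<le> u \<or> y = v"
      using saturated_chain_total[OF Cs C(2) uv(1)] \<open>y \<le> v\<close> uv(3) unfolding covers_def by (metis less_le)
    then show ?thesis
    proof
      assume "y = v"
      then have "hy v \<le> hy x" using hs s by auto
      then show ?thesis using below uv' True \<open>y = v\<close> by auto
    qed (use \<open>u \<le> x\<close> in auto)
  next
    case False
    have "(c s, s) \<in> pos ` ({u, v} \<inter> {u', v'})"
      using noncrossing[OF uv(3) uv'(3) False] uv(4) uv'(4) s by auto
    then obtain z where z: "z \<in> C" "z \<in> E" "pos z = (c s, s)" using uv uv' by auto
    then have "hy z = s" by simp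
    then show ?thesis using above[of z] below[of z] z s by (auto intro: order_trans)
  qed
qed

section \<open>The left-of relation\<close>

definition incomp :: "'a \<Rightarrow> 'a \<Rightarrow> bool" where "incomp x y \<longleftrightarrow> \<not> x \<le> y \<and> \<not> y \<le> x"

text \<open>The order of the two ends is left open, because either of two incomparable elements may
  be drawn higher.\<close>

definition in_between :: "real \<Rightarrow> real \<Rightarrow> real \<Rightarrow> bool" where
  "in_between r s u \<longleftrightarrow> (r \<le> s \<and> s \<le> u) \<or> (u \<le> s \<and> s \<le> r)"

lemma in_between_ends: "in_between r r s" "in_between r s s" by (auto simp: in_between_def)

text \<open>A common point between the two heights would make \<open>x\<close> and \<open>y\<close>
  comparable, in the direction given by their heights.\<close>

lemma drawn_chains_disjoint:
  assumes "drawn_chain E e" "x \<in> E" "drawn_chain C c" "y \<in> C" "incomp x y" "in_between (hy x) s (hy y)"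
  shows "e s \<noteq> c s"
  using drawn_chain_meet[OF assms(1,2,3,4), of s] drawn_chain_meet[OF assms(3,4,1,2), of s] assms(5,6)
  unfolding incomp_def in_between_def by metis

lemma drawn_chains_side:
  assumes "drawn_chain E e" "x \<in> E" "drawn_chain C c" "y \<in> C" "incomp x y"
    "in_between (hy x) r (hy y)" "in_between (hy x) s (hy y)" "e r < c r"
  shows "e s < c s"
proof -
  let ?l = "min (hy x) (hy y)" and ?u = "max (hy x) (hy y)"
  have bt: "in_between (hy x) s (hy y) \<longleftrightarrow> s \<in> {?l..?u}" for s by (auto simp: in_between_def)
  have "{?l..?u} \<subseteq> {hy b..hy t}" using hy_mono[OF least] hy_mono[OF greatest] by auto
  then have "continuous_on {?l..?u} e" "continuous_on {?l..?u} c"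
    using assms(1,3) continuous_on_subset unfolding drawn_chain_def by blast+
  then show ?thesis
    using sign_constant[of ?l ?u e c r s] drawn_chains_disjoint[OF assms(1-5)] assms(6-8) bt by blast
qed

definition left_of :: "'a \<Rightarrow> 'a \<Rightarrow> bool" where
  "left_of x y \<longleftrightarrow> incomp x y \<and> (\<exists>E e C c. drawn_chain E e \<and> x \<in> E \<and> drawn_chain C c \<and> y \<in> C \<and> e (hy x) < c (hy x))"

text \<open>Independence of the chosen chains and of the height. All chains through \<open>x\<close>
  agree at height \<open>hy x\<close>, so \<open>E\<close> can be exchanged there; the inequality is
  then carried to height \<open>hy y\<close>, where \<open>C\<close> can be exchanged.\<close>

lemma left_ofD:
  assumes "left_of x y" "drawn_chain E e" "x \<in> E" "drawn_chain C c" "y \<in> C" "in_between (hy x) s (hy y)"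
  shows "e s < c s"
proof -
  obtain E' e' C' c' where p: "drawn_chain E' e'" "x \<in> E'" "drawn_chain C' c'" "y \<in> C'" "e' (hy x) < c' (hy x)"
    and i: "incomp x y"
    using assms(1) unfolding left_of_def by blast
  have bt: "in_between (hy x) (hy x) (hy y)" "in_between (hy x) (hy y) (hy y)" by (auto simp: in_between_def)
  have "e (hy x) < c' (hy x)" using p assms(2,3) by (auto simp: drawn_chain_def)
  then have "e (hy y) < c' (hy y)" using drawn_chains_side[OF assms(2,3) p(3,4) i bt] by blast
  then have "e (hy y) < c (hy y)" using p assms(4,5) by (auto simp: drawn_chain_def)
  then show ?thesis using drawn_chains_side[OF assms(2-5) i bt(2) assms(6)] by blast
qed

lemma left_of_total:
  assumes "incomp x y"
  shows "left_of x y \<or> left_of y x"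
proof -
  obtain E e C c where p: "drawn_chain E e" "x \<in> E" "drawn_chain C c" "y \<in> C"
    using ex_drawn_chain_through[of x x] ex_drawn_chain_through[of y y] by (metis order_refl)
  have bt: "in_between (hy x) (hy x) (hy y)" "in_between (hy y) (hy x) (hy x)" "in_between (hy y) (hy y) (hy x)"
    by (auto simp: in_between_def)
  have i': "incomp y x" using assms by (simp add: incomp_def)
  consider "e (hy x) < c (hy x)" | "c (hy x) < e (hy x)"
    using drawn_chains_disjoint[OF p assms bt(1)] by linarith
  then show ?thesis
  proof cases
    case 1 then show ?thesis using p assms unfolding left_of_def by blast
  next
    case 2
    \<comment> \<open>\<open>left_of y x\<close> is tested at the height of \<open>y\<close>, so the
      inequality is moved there from the height of \<open>x\<close>.\<close>
    then have "c (hy y) < e (hy y)" using drawn_chains_side[OF p(3,4,1,2) i' bt(2,3)] by blast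
    then show ?thesis using p i' unfolding left_of_def by blast
  qed
qed

text \<open>At the height of the middle element all three relations can be evaluated, and they form
  a strict cycle of reals.\<close>

lemma left_of_no_cycle:
  assumes "left_of x y" "left_of y z" "left_of z x" "in_between (hy x) (hy y) (hy z)"
  shows False
proof -
  obtain E e C c G g where p: "drawn_chain E e" "x \<in> E" "drawn_chain C c" "y \<in> C" "drawn_chain G g" "z \<in> G"
    using ex_drawn_chain_through[of x x] ex_drawn_chain_through[of y y] ex_drawn_chain_through[of z z]
    by (metis order_refl)
  have "e (hy y) < c (hy y)" using left_ofD[OF assms(1) p(1-4)] in_between_ends by blast
  moreover have "c (hy y) < g (hy y)" using left_ofD[OF assms(2) p(3-6)] in_between_ends by blast
  moreover have "g (hy y) < e (hy y)"
    using left_ofD[OF assms(3) p(5,6,1,2), of "hy y"] assms(4) by (auto simp: in_between_def)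
  ultimately show False by simp
qed

text \<open>If \<open>x\<close> and \<open>z\<close> were comparable, one chain through both would
  pass on both sides of \<open>y\<close> at the height of \<open>y\<close>. If \<open>z\<close> were
  left of \<open>x\<close>, there would be a cycle, and one of the three heights lies between the
  other two.\<close>

lemma left_of_trans:
  assumes "left_of x y" "left_of y z"
  shows "left_of x z"
proof -
  have "incomp x z"
  proof (rule ccontr)
    assume "\<not> incomp x z"
    then obtain G g where G: "drawn_chain G g" "x \<in> G" "z \<in> G"
      using ex_drawn_chain_through unfolding incomp_def by metis
    obtain C c where C: "drawn_chain C c" "y \<in> C" using ex_drawn_chain_through[of y y] by blast
    have "g (hy y) < c (hy y)" using left_ofD[OF assms(1) G(1,2) C] in_between_ends by blast
    moreover have "c (hy y) < g (hy y)" using left_ofD[OF assms(2) C G(1,3)] in_between_ends by blast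
    ultimately show False by simp
  qed
  moreover have "\<not> left_of z x"
  proof
    assume z: "left_of z x"
    have "in_between (hy x) (hy y) (hy z) \<or> in_between (hy y) (hy z) (hy x) \<or> in_between (hy z) (hy x) (hy y)"
      unfolding in_between_def by linarith
    then show False using left_of_no_cycle assms z by blast
  qed
  ultimately show ?thesis using left_of_total by blast
qed

lemma conjugate_order_left_of: "conjugate_order left_of"
  unfolding conjugate_order_def
proof (intro conjI allI impI)
  show "left_of x z" if "left_of x y" "left_of y z" for x y z using left_of_trans that .
qed (use left_of_total in \<open>auto simp: left_of_def incomp_def\<close>)

end

lemma planar_lattice_conjugate_order:
  assumes "planar_lattice TYPE('a::{finite,lattice})"
  obtains R :: "'a::{finite,lattice} \<Rightarrow> 'a \<Rightarrow> bool" where "conjugate_order R"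
proof -
  obtain pos :: "'a \<Rightarrow> real \<times> real" where pos: "inj pos \<and>
        (\<forall>a b. covers a b \<longrightarrow> snd (pos a) < snd (pos b)) \<and>
        (\<forall>a b c d. covers a b \<longrightarrow> covers c d \<longrightarrow> (a, b) \<noteq> (c, d) \<longrightarrow>
            closed_segment (pos a) (pos b) \<inter> closed_segment (pos c) (pos d)
              \<subseteq> pos ` ({a, b} \<inter> {c, d})) \<and>
        (\<forall>a b z. covers a b \<longrightarrow> z \<noteq> a \<longrightarrow> z \<noteq> b \<longrightarrow>
            pos z \<notin> closed_segment (pos a) (pos b))"
    using assms unfolding planar_lattice_def by (elim exE)
  let ?b = "Inf_fin (UNIV :: 'a set)" and ?t = "Sup_fin (UNIV :: 'a set)"
  have bt: "?b \<le> x" "x \<le> ?t" for x :: 'a by (auto intro: Inf_fin.coboundedI Sup_fin.coboundedI)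
  show thesis
  proof (cases "?b = ?t")
    \<comment> \<open>The lattice has one element and no incomparable pairs, so the empty relation
      is conjugate.\<close>
    case True
    then have "x = y" for x y :: 'a using bt by (metis antisym)
    then have "x \<le> y" for x y :: 'a by (metis order_refl)
    then have "conjugate_order (\<lambda>(x::'a) y. False)" by (auto simp: conjugate_order_def)
    then show ?thesis using that by blast
  next
    case False
    then interpret planar_drawing pos ?b ?t
    proof (unfold_locales, goal_cases)
      case (2 x y u v)
      then show ?case using pos by presburger
    qed (use pos bt in simp_all)
    show ?thesis using that conjugate_order_left_of .
  qed
qed

section \<open>Linear representations of integer polymatroids\<close>

text \<open>Infinitely many scalars prevent a space from being a finite union of proper subspaces;
  this is the source of generic vectors.\<close>

locale vector_space_infinite_field = vector_space scale
  for scale :: "'a::field \<Rightarrow> 'b::ab_group_add \<Rightarrow> 'b" +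
  assumes infinite_field: "infinite (UNIV :: 'a set)"
begin

text \<open>The ambient space may have infinite dimension, and \<open>dim\<close> is 0 for a space
  with an infinite basis. The predicate singles out the subspaces on which \<open>dim\<close> is
  meaningful.\<close>

definition fin_dim :: "'b set \<Rightarrow> bool" where
  "fin_dim U \<longleftrightarrow> (\<exists>B. finite B \<and> U = span B)"

lemma fin_dim_span: "finite B \<Longrightarrow> fin_dim (span B)"
  by (auto simp: fin_dim_def)

lemma fin_dim_subspace: "fin_dim U \<Longrightarrow> subspace U"
  by (auto simp: fin_dim_def)

lemma fin_dim_basis:
  assumes "fin_dim U"
  obtains B where "finite B" "independent B" "span B = U" "card B = dim U"
proof -
  obtain T where T: "finite T" "U = span T" using assms by (auto simp: fin_dim_def)
  obtain B where B: "B \<subseteq> U" "independent B" "U \<subseteq> span B" "card B = dim U" by (rule basis_exists)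
  have "finite B" using independent_span_bound[OF T(1) B(2)] B T by auto
  moreover have "span B = U" using B T by (simp add: span_minimal subset_antisym)
  ultimately show thesis using that B by blast
qed

lemma span_Un_span: "span (span A \<union> span B) = span (A \<union> B)"
  by (intro subset_antisym span_minimal) (auto intro: span_mono[THEN subsetD] span_base)

lemma span_insert_span: "span (insert v (span B)) = span (insert v B)"
  by (intro subset_antisym span_minimal) (auto intro: span_mono[THEN subsetD] span_base)

lemma fin_dim_Un: "fin_dim U \<Longrightarrow> fin_dim W \<Longrightarrow> fin_dim (span (U \<union> W))"
  unfolding fin_dim_def by (metis span_Un_span finite_Un)

lemma fin_dim_insert: "fin_dim U \<Longrightarrow> fin_dim (span (insert v U))"
  unfolding fin_dim_def by (metis span_insert_span finite_insert)

lemma dim_span_insert: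
  assumes "fin_dim U" "v \<notin> U"
  shows "dim (span (insert v U)) = Suc (dim U)"
proof -
  obtain B where B: "finite B" "independent B" "span B = U" "card B = dim U"
    using fin_dim_basis assms(1) by blast
  then have "independent (insert v B)" using assms by (simp add: independent_insertI)
  then have "dim (insert v B) = card (insert v B)" by (rule dim_eq_card_independent)
  moreover have "v \<notin> B" using assms B span_base by blast
  ultimately show ?thesis using B by (metis span_insert_span dim_span card_insert_disjoint)
qed

lemma fin_dim_card_le:
  assumes "fin_dim W" "independent B" "B \<subseteq> W"
  shows "card B \<le> dim W"
proof -
  obtain T where "finite T" "independent T" "span T = W" "card T = dim W"
    using fin_dim_basis assms(1) by blast
  then show ?thesis using independent_span_bound[of T B] assms by auto
qed

lemma fin_dim_mono:
  assumes "fin_dim U" "fin_dim W" "U \<subseteq> W"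
  shows "dim U \<le> dim W"
  by (metis assms fin_dim_basis fin_dim_card_le span_superset subset_trans)

lemma fin_dim_eqI:
  assumes "fin_dim U" "fin_dim W" "U \<subseteq> W" "dim W \<le> dim U"
  shows "U = W"
proof (rule ccontr)
  assume "U \<noteq> W"
  then obtain w where w: "w \<in> W" "w \<notin> U" using assms(3) by blast
  have "span (insert w U) \<subseteq> W"
    using w assms by (intro span_minimal fin_dim_subspace) auto
  then have "Suc (dim U) \<le> dim W"
    using fin_dim_mono[OF fin_dim_insert[OF assms(1)] assms(2)] dim_span_insert[OF assms(1) w(2)] by metis
  then show False using assms(4) by simp
qed

section \<open>Generic vectors and subspaces\<close>

text \<open>Move from \<open>v\<close>, which avoids \<open>F\<close>, along a direction
  \<open>w\<close> outside \<open>U\<close>. Each member of \<open>F\<close> excludes at most one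
  scalar, since two points of the line in it would force \<open>v\<close> into it; \<open>U\<close>
  excludes only 0 when it contains \<open>v\<close>.\<close>

lemma subspace_not_covered:
  assumes I: "subspace I" and "finite F"
    and F: "\<And>U. U \<in> F \<Longrightarrow> subspace U \<and> \<not> I \<subseteq> U"
  shows "\<exists>v\<in>I. \<forall>U\<in>F. v \<notin> U"
  using \<open>finite F\<close> F
proof (induction F rule: finite_induct)
  case empty
  then show ?case using subspace_0[OF I] by blast
next
  case (insert U F)
  then obtain v where v: "v \<in> I" "\<forall>U\<in>F. v \<notin> U" by auto
  obtain w where w: "w \<in> I" "w \<notin> U" using insert.prems by blast
  show ?case
  proof (cases "v \<in> U")
    case False
    then show ?thesis using v by auto
  next
    case True
    have uniq: "a = c" if G: "G \<in> F" and vc: "v + scale c w \<in> G" and va: "v + scale a w \<in> G" for G a c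
    proof (rule ccontr)
      assume ne: "a \<noteq> c"
      have G': "subspace G" using insert.prems G by blast
      have "(v + scale a w) - (v + scale c w) \<in> G" using subspace_diff[OF G' va vc] .
      then have "scale (a - c) w \<in> G" by (simp add: scale_left_diff_distrib)
      then have "scale (c / (a - c)) (scale (a - c) w) \<in> G" using subspace_scale[OF G'] by blast
      then have "scale c w \<in> G" using ne by simp
      then have "v \<in> G" using subspace_diff[OF G' vc, of "scale c w"] by simp
      then show False using v G by blast
    qed
    have "finite (\<Union>G\<in>F. {a. v + scale a w \<in> G})"
    proof (rule finite_UN_I[OF insert.hyps(1)])
      fix G assume "G \<in> F"
      then have "{a. v + scale a w \<in> G} \<subseteq> {SOME a. v + scale a w \<in> G}"
        using uniq someI_ex by (smt (verit) mem_Collect_eq singletonI subsetI)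
      then show "finite {a. v + scale a w \<in> G}" using finite_subset by blast
    qed
    then have "finite (insert 0 (\<Union>G\<in>F. {a. v + scale a w \<in> G}))" by simp
    then obtain a where a: "a \<notin> insert 0 (\<Union>G\<in>F. {a. v + scale a w \<in> G})"
      using infinite_field ex_new_if_finite by blast
    have "v + scale a w \<notin> U"
    proof
      assume "v + scale a w \<in> U"
      then have "scale a w \<in> U"
        using subspace_diff[of U "v + scale a w" v] insert.prems True by auto
      then have "scale (1 / a) (scale a w) \<in> U" using subspace_scale insert.prems by blast
      then show False using a w by simp
    qed
    moreover have "v + scale a w \<in> I" using I v w by (simp add: subspace_add subspace_scale)
    ultimately show ?thesis using a by blast
  qed
qed

text \<open>\<open>D\<close> grows by one vector at a time, chosen in \<open>I\<close> outside
  \<open>D\<close> and outside every sum of \<open>A j\<close> and \<open>D\<close> that does not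
  yet contain \<open>I\<close>. Each such sum gains a dimension until it reaches \<open>I\<close>,
  whence the minimum.\<close>

lemma generic_subspace_dim:
  assumes O: "fin_dim O'" and I: "fin_dim I" "O' \<subseteq> I"
    and "finite J" and A: "\<And>j. j \<in> J \<Longrightarrow> fin_dim (A j) \<and> A j \<subseteq> I"
  shows "dim O' + n \<le> dim I \<Longrightarrow> (\<And>j. j \<in> J \<Longrightarrow> O' \<subseteq> A j) \<Longrightarrow>
    \<exists>D. fin_dim D \<and> O' \<subseteq> D \<and> D \<subseteq> I \<and> dim D = dim O' + n \<and>
      (\<forall>j\<in>J. dim (span (A j \<union> D)) \<ge> min (dim I) (dim (A j) + n))"
proof (induction n)
  case 0
  have "span (A j \<union> O') = A j" if "j \<in> J" for j
    using 0(2)[OF that] A[OF that] fin_dim_subspace by (metis Un_absorb2 span_eq_iff)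
  then show ?case using O I by (intro exI[of _ O']) auto
next
  case (Suc n)
  then obtain D where D: "fin_dim D" "O' \<subseteq> D" "D \<subseteq> I" "dim D = dim O' + n"
    "\<And>j. j \<in> J \<Longrightarrow> dim (span (A j \<union> D)) \<ge> min (dim I) (dim (A j) + n)" by auto
  have DI: "\<not> I \<subseteq> D" using fin_dim_mono[OF I(1) D(1)] D(4) Suc.prems by auto
  let ?F = "insert D ((\<lambda>j. span (A j \<union> D)) ` {j\<in>J. \<not> I \<subseteq> span (A j \<union> D)})"
  have "\<exists>v\<in>I. \<forall>U\<in>?F. v \<notin> U"
    using \<open>finite J\<close> DI D fin_dim_subspace I by (intro subspace_not_covered) auto
  then obtain v where v: "v \<in> I" "v \<notin> D"
    "\<And>j. j \<in> J \<Longrightarrow> \<not> I \<subseteq> span (A j \<union> D) \<Longrightarrow> v \<notin> span (A j \<union> D)" by auto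
  define D' where "D' = span (insert v D)"
  have D': "fin_dim D'" "D \<subseteq> D'" "dim D' = Suc (dim D)"
    using fin_dim_insert[OF D(1)] dim_span_insert[OF D(1) v(2)] span_superset[of "insert v D"]
    unfolding D'_def by auto
  have "D' \<subseteq> I" unfolding D'_def using v D I fin_dim_subspace by (intro span_minimal) auto
  moreover have "dim (span (A j \<union> D')) \<ge> min (dim I) (dim (A j) + Suc n)" if j: "j \<in> J" for j
  proof -
    have fd: "fin_dim (span (A j \<union> D))" "fin_dim (span (A j \<union> D'))"
      using fin_dim_Un A[OF j] D D' by auto
    have AD: "span (A j \<union> D) \<subseteq> span (A j \<union> D')" using D' by (intro span_mono) auto
    show ?thesis
    proof (cases "I \<subseteq> span (A j \<union> D)")
      case True
      then have "dim I \<le> dim (span (A j \<union> D'))" using fin_dim_mono[OF I(1) fd(2)] AD by blast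
      then show ?thesis by linarith
    next
      case False
      have "v \<in> span (A j \<union> D')" unfolding D'_def by (meson UnI2 insertI1 span_base)
      then have "span (insert v (span (A j \<union> D))) \<subseteq> span (A j \<union> D')"
        using AD by (intro span_minimal) auto
      then have "Suc (dim (span (A j \<union> D))) \<le> dim (span (A j \<union> D'))"
        using fin_dim_mono[OF fin_dim_insert[OF fd(1)] fd(2)] dim_span_insert[OF fd(1) v(3)[OF j False]]
        by metis
      then show ?thesis using D(5)[OF j] by linarith
    qed
  qed
  ultimately show ?case using D D' by (intro exI[of _ D']) auto
qed

text \<open>The last hypothesis says that the minimum in the preceding lemma is attained by
  \<open>dim I\<close>.\<close>

lemma generic_subspace:
  assumes "fin_dim O'" and I: "fin_dim I" and "O' \<subseteq> I"
    and "finite J" and A: "\<And>j. j \<in> J \<Longrightarrow> fin_dim (A j) \<and> O' \<subseteq> A j \<and> A j \<subseteq> I"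
    and "dim O' \<le> k" "k \<le> dim I" and big: "\<And>j. j \<in> J \<Longrightarrow> dim I + dim O' \<le> k + dim (A j)"
  obtains D where "fin_dim D" "O' \<subseteq> D" "D \<subseteq> I" "dim D = k" "\<And>j. j \<in> J \<Longrightarrow> span (A j \<union> D) = I"
proof -
  obtain D where D: "fin_dim D" "O' \<subseteq> D" "D \<subseteq> I" "dim D = dim O' + (k - dim O')"
    "\<And>j. j \<in> J \<Longrightarrow> dim (span (A j \<union> D)) \<ge> min (dim I) (dim (A j) + (k - dim O'))"
    using generic_subspace_dim[OF assms(1-4), of A "k - dim O'"] A assms(6,7) by auto
  have "span (A j \<union> D) = I" if j: "j \<in> J" for j
  proof (rule fin_dim_eqI)
    show "fin_dim (span (A j \<union> D))" using fin_dim_Un A[OF j] D by auto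
    show "span (A j \<union> D) \<subseteq> I" using A[OF j] D I fin_dim_subspace by (intro span_minimal) auto
    show "dim I \<le> dim (span (A j \<union> D))" using D(5)[OF j] big[OF j] assms(6) by linarith
  qed (rule I)
  then show thesis using that[of D] D assms(6) by auto
qed

text \<open>Induction over the sublattices containing both bounds, among which dismantling stays.
  Only joins are mapped to sums; nothing is asserted about meets, and this leaves the freedom to
  choose the space at \<open>d\<close> generically.\<close>

lemma modular_linear_representation:
  fixes h :: "'l::{finite,lattice} \<Rightarrow> nat" and R :: "'l \<Rightarrow> 'l \<Rightarrow> bool"
  assumes B: "infinite B" "independent B"
    and modular: "modular_lattice TYPE('l)" and R: "conjugate_order R"
    and b: "\<And>x. b \<le> x" and t: "\<And>x. x \<le> t"
    and mono: "\<And>x y. x \<le> y \<Longrightarrow> h x \<le> h y"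
    and submod: "\<And>x y. h (sup x y) + h (inf x y) \<le> h x + h y"
  shows "sublattice S \<Longrightarrow> b \<in> S \<Longrightarrow> t \<in> S \<Longrightarrow>
    \<exists>V. (\<forall>x\<in>S. fin_dim (V x) \<and> dim (V x) = h x) \<and> (\<forall>x\<in>S. \<forall>y\<in>S. V (sup x y) = span (V x \<union> V y))"
proof (induction S rule: finite_psubset_induct[OF finite])
  case (1 S)
  show ?case
  proof (cases "S = {b, t}")
    case True
    \<comment> \<open>Nested subsets of one independent family settle the two bounds. If
      \<open>b = t\<close>, both have cardinality \<open>h t\<close> and coincide.\<close>
    obtain T where T: "T \<subseteq> B" "finite T" "card T = h t"
      using infinite_arbitrarily_large[OF B(1)] by blast
    obtain T' where T': "T' \<subseteq> T" "card T' = h b"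
      using obtain_subset_with_card_n[of "h b" T] mono[OF t[of b]] T by metis
    have ind: "independent T" "independent T'" using independent_mono[OF B(2)] T T' by auto
    have fin: "finite T'" using T T' finite_subset by blast
    define V where "V x = (if x = t then span T else span T')" for x
    have dims: "fin_dim (V x) \<and> dim (V x) = h x" if "x \<in> S" for x
      using that True T T' ind fin dim_eq_card_independent fin_dim_span by (auto simp: V_def)
    have "V (sup x y) = span (V x \<union> V y)" if "x \<in> S" "y \<in> S" for x y
    proof -
      have TT: "T' \<union> T = T" "T \<union> T' = T" using T' by auto
      have s: "sup b t = t" "sup t b = t" "sup t t = t" "sup b b = b"
        using b t by (auto simp: sup_absorb1 sup_absorb2)
      have "x = b \<or> x = t" "y = b \<or> y = t" using that True by auto
      then show ?thesis by (elim disjE) (simp_all add: V_def span_Un_span span_span TT s)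
    qed
    then show ?thesis using dims by (intro exI[of _ V]) blast
  next
    case False
    obtain d where d: "d \<in> S" "d \<noteq> b" "d \<noteq> t" and sub: "sublattice (S - {d})"
      using ex_doubly_irreducible[OF finite R] 1(3-5) b t False by metis
    define S' where "S' = S - {d}"
    have "S' \<subset> S" using d by (auto simp: S'_def)
    moreover have bt: "b \<in> S'" "t \<in> S'" using 1 d by (auto simp: S'_def)
    ultimately obtain V where V: "\<And>x. x \<in> S' \<Longrightarrow> fin_dim (V x)" "\<And>x. x \<in> S' \<Longrightarrow> dim (V x) = h x"
      "\<And>x y. x \<in> S' \<Longrightarrow> y \<in> S' \<Longrightarrow> V (sup x y) = span (V x \<union> V y)"
      using 1(2)[of S'] sub unfolding S'_def by blast
    have Vmono: "V x \<subseteq> V y" if "x \<in> S'" "y \<in> S'" "x \<le> y" for x y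
      using V(3)[OF that(1,2)] that(3) span_superset[of "V x \<union> V y"] by (simp add: sup_absorb2)
    have S'sup: "sup x y \<in> S'" and S'inf: "inf x y \<in> S'" if "x \<in> S'" "y \<in> S'" for x y
      using sub that unfolding sublattice_def S'_def by blast+
    have Ssup: "sup x y \<in> S" and Sinf: "inf x y \<in> S" if "x \<in> S" "y \<in> S" for x y
      using 1(3) that unfolding sublattice_def by blast+
    have fin_sup: "Sup_fin X \<in> S'" if "X \<noteq> {}" "X \<subseteq> S'" for X
      using finite[of X] that by (induction X rule: finite_ne_induct) (auto intro: S'sup)
    have fin_inf: "Inf_fin X \<in> S'" if "X \<noteq> {}" "X \<subseteq> S'" for X
      using finite[of X] that by (induction X rule: finite_ne_induct) (auto intro: S'inf)
    \<comment> \<open>As \<open>S'\<close> is a sublattice, the join of its elements below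
      \<open>d\<close> is again one of them, and dually for the meet; these are the neighbours of
      \<open>d\<close>.\<close>
    define lo where "lo = Sup_fin {x \<in> S'. x \<le> d}"
    define hi where "hi = Inf_fin {x \<in> S'. d \<le> x}"
    have ne: "{x \<in> S'. x \<le> d} \<noteq> {}" "{x \<in> S'. d \<le> x} \<noteq> {}" using bt b t by auto
    have lo: "lo \<in> S'" "lo \<le> d" "\<And>x. x \<in> S' \<Longrightarrow> x \<le> d \<Longrightarrow> x \<le> lo"
      using fin_sup[OF ne(1)] ne(1) unfolding lo_def
      by (auto intro: Sup_fin.coboundedI simp: Sup_fin.bounded_iff)
    have hi: "hi \<in> S'" "d \<le> hi" "\<And>x. x \<in> S' \<Longrightarrow> d \<le> x \<Longrightarrow> hi \<le> x"
      using fin_inf[OF ne(2)] ne(2) unfolding hi_def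
      by (auto intro: Inf_fin.coboundedI simp: Inf_fin.bounded_iff)
    have lohi: "lo \<le> hi" using lo hi by auto
    define J where "J = {y \<in> S'. \<not> y \<le> d \<and> \<not> d \<le> y}"
    define a where "a y = inf (sup lo y) hi" for y
    have md: "sup p (inf x q) = inf (sup p x) q" if "p \<le> q" for p q x :: 'l
      using modular that unfolding modular_lattice_def by blast
    have aS: "a y \<in> S'" "lo \<le> a y" "a y \<le> hi" if "y \<in> J" for y
      using that lo(1) hi(1) lohi S'sup S'inf by (auto simp: a_def J_def intro: le_infI1)
    have hi_le: "hi \<le> sup d y" if y: "y \<in> J" for y
    proof -
      have "sup d y \<in> S" "sup d y \<noteq> d" using y Ssup d by (auto simp: J_def S'_def le_iff_sup sup_commute)
      then show ?thesis using hi(3) by (auto simp: S'_def)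
    qed
    have le_lo: "inf d y \<le> lo" if y: "y \<in> J" for y
    proof -
      have "inf d y \<in> S" "inf d y \<noteq> d" using y Sinf d by (auto simp: J_def S'_def le_iff_inf)
      then show ?thesis using lo(3) by (auto simp: S'_def)
    qed
    \<comment> \<open>The modular law is used for \<open>d \<le> hi\<close> here and for
      \<open>lo \<le> d\<close> in the dual statement.\<close>
    have a_sup: "sup d (a y) = hi" if y: "y \<in> J" for y
    proof -
      have "sup d (a y) = inf (sup d (sup lo y)) hi" using md[OF hi(2), of "sup lo y"] by (simp add: a_def)
      also have "sup d (sup lo y) = sup d y" using lo(2) by (metis sup.assoc sup.absorb1)
      finally show ?thesis using hi_le[OF y] by (simp add: inf_absorb2)
    qed
    have a_inf: "inf d (a y) = lo" if y: "y \<in> J" for y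
    proof -
      have "inf d (a y) = inf (sup lo y) d"
        unfolding a_def using hi(2) by (metis inf.absorb2 inf.assoc inf.commute)
      also have "\<dots> = sup lo (inf y d)" using md[OF lo(2)] by simp
      finally show ?thesis using le_lo[OF y] by (simp add: sup_absorb1 inf_commute)
    qed
    obtain D where D: "fin_dim D" "V lo \<subseteq> D" "D \<subseteq> V hi" "dim D = h d"
      "\<And>y. y \<in> J \<Longrightarrow> span (V (a y) \<union> D) = V hi"
    proof (rule generic_subspace[OF V(1)[OF lo(1)] V(1)[OF hi(1)], of J "\<lambda>y. V (a y)" "h d"])
      show "fin_dim (V (a y)) \<and> V lo \<subseteq> V (a y) \<and> V (a y) \<subseteq> V hi" if "y \<in> J" for y
        using V(1) Vmono aS[OF that] lo(1) hi(1) by blast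
      show "dim (V hi) + dim (V lo) \<le> h d + dim (V (a y))" if "y \<in> J" for y
        using submod[of d "a y"] a_sup[OF that] a_inf[OF that] V(2) aS[OF that] lo(1) hi(1) by simp
    qed (use Vmono lo hi lohi V(2) mono in auto)
    define W where "W x = (if x = d then D else V x)" for x
    have W: "W d = D" "\<And>x. x \<in> S' \<Longrightarrow> W x = V x" by (auto simp: W_def S'_def)
    have spanV: "span (V x) = V x" if "x \<in> S'" for x using V(1)[OF that] fin_dim_subspace by (simp add: span_eq_iff)
    have spanD: "span D = D" using D(1) fin_dim_subspace by (simp add: span_eq_iff)
    have Wd: "W (sup d y) = span (D \<union> V y)" if y: "y \<in> S'" for y
    proof (cases "y \<le> d")
      case True
      then have "V y \<subseteq> D" using Vmono[OF y lo(1)] lo(3)[OF y] D(2) by blast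
      then show ?thesis using True spanD by (metis sup_absorb1 W(1) Un_absorb2)
    next
      case nle: False
      show ?thesis
      proof (cases "d \<le> y")
        case True
        then have "D \<subseteq> V y" using Vmono[OF hi(1) y] hi(3)[OF y] D(3) by blast
        then show ?thesis using True spanV y by (metis sup_absorb2 W(2) Un_absorb1)
      next
        case False
        then have J: "y \<in> J" using nle y by (simp add: J_def)
        have "sup d y = sup hi y" using hi_le[OF J] hi(2) by (simp add: antisym le_supI1)
        moreover have "sup hi y \<in> S'" using S'sup hi(1) y by blast
        ultimately have 1: "W (sup d y) = span (V hi \<union> V y)" using W V(3) hi(1) y by metis
        \<comment> \<open>\<open>V (a y)\<close> is contained in the sum of \<open>V lo\<close> and
          \<open>V y\<close>, hence in that of \<open>D\<close> and \<open>V y\<close>. Together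
          with \<open>D\<close> it generates \<open>V hi\<close>, so the latter sum contains
          \<open>V hi\<close>.\<close>
        have "V (a y) \<subseteq> V (sup lo y)" using aS[OF J] y S'sup lo(1) by (intro Vmono) (auto simp: a_def)
        also have "\<dots> = span (V lo \<union> V y)" using V(3) lo(1) y by blast
        also have "\<dots> \<subseteq> span (D \<union> V y)" using D(2) by (intro span_mono) auto
        finally have "span (V (a y) \<union> D) \<subseteq> span (D \<union> V y)"
          using span_superset[of "D \<union> V y"] by (intro span_minimal) auto
        then have "V hi \<union> V y \<subseteq> span (D \<union> V y)" using D(5)[OF J] span_superset[of "D \<union> V y"] by blast
        then have "span (V hi \<union> V y) \<subseteq> span (D \<union> V y)" by (intro span_minimal) auto
        moreover have "span (D \<union> V y) \<subseteq> span (V hi \<union> V y)" using D(3) by (intro span_mono) auto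
        ultimately show ?thesis using 1 by blast
      qed
    qed
    have SS: "x = d \<or> x \<in> S'" if "x \<in> S" for x using that by (auto simp: S'_def)
    have "W (sup x y) = span (W x \<union> W y)" if xy: "x \<in> S" "y \<in> S" for x y
    proof -
      consider "x = d" "y = d" | "x = d" "y \<in> S'" | "x \<in> S'" "y = d" | "x \<in> S'" "y \<in> S'"
        using SS[OF xy(1)] SS[OF xy(2)] by blast
      then show ?thesis
      proof cases
        case 1 then show ?thesis using W(1) spanD by (metis sup_idem Un_absorb)
      next
        case 2 then show ?thesis using W Wd by simp
      next
        case 3 then show ?thesis using W Wd by (metis sup_commute Un_commute)
      next
        case 4 then show ?thesis using W V(3) S'sup by metis
      qed
    qed
    moreover have "fin_dim (W x) \<and> dim (W x) = h x" if "x \<in> S" for x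
      using SS[OF that] W V D by auto
    ultimately show ?thesis by (intro exI[of _ W]) blast
  qed
qed

end

section \<open>Shannon inequalities\<close>

text \<open>Entropy is the expectation of this function, which makes integration theory available.
  Where the probability is 0 its value is 0, because \<open>ln 0 = 0\<close>.\<close>

definition surprisal :: "'b pmf \<Rightarrow> 'b \<Rightarrow> real" where
  "surprisal q v = - log 2 (pmf q v)"

lemma surprisal_nonneg: "0 \<le> surprisal q v"
proof (cases "pmf q v = 0")
  case False
  then have "0 < pmf q v" by (simp add: less_le)
  then show ?thesis using pmf_le_1[of q v] by (simp add: surprisal_def)
qed (simp add: surprisal_def log_def)

text \<open>For real families unconditional and absolute summability agree, and the latter is
  integrability for the density \<open>pmf q\<close> over counting measure.\<close>

lemma finite_entropy_iff: "finite_entropy q \<longleftrightarrow> integrable (measure_pmf q) (surprisal q)"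
proof -
  have "integrable (measure_pmf q) (surprisal q) \<longleftrightarrow>
      integrable (count_space UNIV) (\<lambda>v. pmf q v *\<^sub>R surprisal q v)"
    by (subst measure_pmf_eq_density) (rule integrable_density, auto)
  also have "\<dots> \<longleftrightarrow> (\<lambda>v. pmf q v * surprisal q v) summable_on UNIV"
    by (subst summable_on_iff_abs_summable_on_real, subst abs_summable_equivalent)
      (simp add: Infinite_Set_Sum.abs_summable_on_def)
  also have "\<dots> \<longleftrightarrow> finite_entropy q"
    unfolding finite_entropy_def
    by (rule summable_on_cong_neutral) (auto simp: surprisal_def set_pmf_iff)
  finally show ?thesis by simp
qed

lemma shannon_entropy_eq:
  assumes "finite_entropy q"
  shows "shannon_entropy q = measure_pmf.expectation q (surprisal q)"
proof -
  have "measure_pmf.expectation q (surprisal q) = infsetsum (\<lambda>v. pmf q v * surprisal q v) UNIV"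
    by (rule pmf_expectation_eq_infsetsum)
  also have "\<dots> = (\<Sum>\<^sub>\<infinity>v. pmf q v * surprisal q v)"
  proof (rule infsetsum_infsum)
    have "integrable (count_space UNIV) (\<lambda>v. pmf q v *\<^sub>R surprisal q v)"
      using assms unfolding finite_entropy_iff
      by (subst (asm) measure_pmf_eq_density) (subst (asm) integrable_density, auto)
    then show "Infinite_Set_Sum.abs_summable_on (\<lambda>v. pmf q v * surprisal q v) UNIV"
      by (simp add: Infinite_Set_Sum.abs_summable_on_def)
  qed
  also have "\<dots> = shannon_entropy q"
    unfolding shannon_entropy_def
    by (rule infsum_cong_neutral) (auto simp: surprisal_def set_pmf_iff)
  finally show ?thesis by simp
qed

lemma surprisal_map_inj:
  assumes "inj_on f (set_pmf q)" "v \<in> set_pmf q"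
  shows "surprisal (map_pmf f q) (f v) = surprisal q v"
  using assms by (simp add: surprisal_def pmf_map_inj)

lemma finite_entropy_map_inj:
  assumes "inj_on f (set_pmf q)"
  shows "finite_entropy (map_pmf f q) \<longleftrightarrow> finite_entropy q"
  unfolding finite_entropy_iff using surprisal_map_inj[OF assms]
  by (simp, intro integrable_cong_AE) (auto simp: AE_measure_pmf_iff)

lemma shannon_entropy_map_inj:
  assumes "inj_on f (set_pmf q)" "finite_entropy q"
  shows "shannon_entropy (map_pmf f q) = shannon_entropy q"
  using assms finite_entropy_map_inj[OF assms(1)] surprisal_map_inj[OF assms(1)]
  by (simp add: shannon_entropy_eq, intro integral_cong_AE) (auto simp: AE_measure_pmf_iff)

lemma shannon_entropy_map:
  assumes "finite_entropy (map_pmf F P)"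
  shows "integrable (measure_pmf P) (\<lambda>\<omega>. surprisal (map_pmf F P) (F \<omega>))"
    and "shannon_entropy (map_pmf F P) = measure_pmf.expectation P (\<lambda>\<omega>. surprisal (map_pmf F P) (F \<omega>))"
  using assms shannon_entropy_eq[OF assms] by (simp_all add: finite_entropy_iff)

text \<open>Gibbs' inequality, from \<open>ln r \<le> r - 1\<close> for the likelihood ratio
  \<open>r\<close>, whose expectation under \<open>p\<close> is at most 1. The inclusion of supports
  keeps \<open>r\<close> positive on the support of \<open>p\<close>.\<close>

lemma pmf_gibbs:
  assumes p: "integrable (measure_pmf p) (surprisal p)" and q: "integrable (measure_pmf p) (surprisal q)"
    and sub: "set_pmf p \<subseteq> set_pmf q"
  shows "measure_pmf.expectation p (surprisal p) \<le> measure_pmf.expectation p (surprisal q)"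
proof -
  define r where "r v = pmf q v / pmf p v" for v
  have "(\<integral>\<^sup>+v. ennreal (r v) \<partial>measure_pmf p) = (\<integral>\<^sup>+v. ennreal (pmf p v * r v) \<partial>count_space UNIV)"
    unfolding nn_integral_measure_pmf by (intro nn_integral_cong) (simp add: ennreal_mult'[symmetric] r_def del: times_divide_eq_right)
  also have "\<dots> \<le> (\<integral>\<^sup>+v. ennreal (pmf q v) \<partial>count_space UNIV)"
    by (intro nn_integral_mono) (simp add: r_def ennreal_leI)
  also have "\<dots> = 1" unfolding nn_integral_pmf by (simp add: measure_pmf.emeasure_space_1[simplified])
  finally have nn: "(\<integral>\<^sup>+v. ennreal (r v) \<partial>measure_pmf p) \<le> 1" .
  have r0: "0 \<le> r v" for v by (simp add: r_def)
  have r: "integrable (measure_pmf p) r"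
  proof (rule integrableI_bounded)
    show "(\<integral>\<^sup>+v. ennreal (norm (r v)) \<partial>measure_pmf p) < \<infinity>"
      using nn r0 by (simp add: le_less_trans[OF _ ennreal_one_less_top])
  qed simp
  have "ennreal (measure_pmf.expectation p r) \<le> ennreal 1"
    using nn nn_integral_eq_integral[OF r] r0 by simp
  then have r1: "measure_pmf.expectation p r \<le> 1" by (simp add: ennreal_le_iff)
  have "measure_pmf.expectation p (surprisal p) \<le> measure_pmf.expectation p (\<lambda>v. surprisal q v + (r v - 1) / ln 2)"
  proof (rule integral_mono_AE)
    show "AE v in measure_pmf p. surprisal p v \<le> surprisal q v + (r v - 1) / ln 2"
    proof (subst AE_measure_pmf_iff, intro ballI)
      fix v assume v: "v \<in> set_pmf p"
      then have pos: "0 < pmf p v" "0 < pmf q v" using sub by (auto simp: pmf_positive)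
      then have "ln (r v) \<le> r v - 1" by (intro ln_le_minus_one) (simp add: r_def)
      then have "ln (pmf q v) - ln (pmf p v) \<le> r v - 1" using pos by (simp add: r_def ln_div)
      then have "(ln (pmf q v) - ln (pmf p v)) / ln 2 \<le> (r v - 1) / ln 2"
        by (intro divide_right_mono) auto
      then show "surprisal p v \<le> surprisal q v + (r v - 1) / ln 2"
        by (simp add: surprisal_def log_def diff_divide_distrib)
    qed
  qed (use p q r in auto)
  also have "\<dots> = measure_pmf.expectation p (surprisal q) + (measure_pmf.expectation p r - 1) / ln 2"
    using q r by simp
  also have "\<dots> \<le> measure_pmf.expectation p (surprisal q)"
    using r1 by (simp add: divide_nonpos_pos)
  finally show ?thesis .
qed

lemma shannon_entropy_nonneg:
  assumes "finite_entropy q"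
  shows "0 \<le> shannon_entropy q"
  unfolding shannon_entropy_eq[OF assms] by (simp add: surprisal_nonneg integral_nonneg_AE)

text \<open>Pointwise: the fibre of \<open>f\<close> through \<open>v\<close> is at least as
  probable as \<open>v\<close> itself.\<close>

lemma shannon_entropy_map_le:
  assumes "finite_entropy q" "finite_entropy (map_pmf f q)"
  shows "shannon_entropy (map_pmf f q) \<le> shannon_entropy q"
  unfolding shannon_entropy_map(2)[OF assms(2)] shannon_entropy_eq[OF assms(1)]
proof (rule integral_mono_AE)
  show "AE v in measure_pmf q. surprisal (map_pmf f q) (f v) \<le> surprisal q v"
  proof (subst AE_measure_pmf_iff, intro ballI)
    fix v assume "v \<in> set_pmf q"
    then have "0 < pmf q v" by (simp add: pmf_positive)
    moreover have "pmf q v \<le> pmf (map_pmf f q) (f v)"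
      unfolding pmf_map by (metis measure_pmf.finite_measure_mono measure_pmf_single
          empty_subsetI insert_subset sets_measure_pmf UNIV_I vimage_singleton_eq)
    ultimately show "surprisal (map_pmf f q) (f v) \<le> surprisal q v"
      by (simp add: surprisal_def log_le_cancel_iff)
  qed
qed (use assms shannon_entropy_map(1)[OF assms(2)] in \<open>auto simp: finite_entropy_iff\<close>)

text \<open>The comparison distribution makes X and Y conditionally independent given their common function Z.\<close>

lemma shannon_entropy_submodular:
  fixes P :: "'w pmf" and X :: "'w \<Rightarrow> 'x" and Y :: "'w \<Rightarrow> 'y" and Z :: "'w \<Rightarrow> 'z"
  assumes fX: "finite_entropy (map_pmf X P)" and fY: "finite_entropy (map_pmf Y P)"
    and fZ: "finite_entropy (map_pmf Z P)" and fXY: "finite_entropy (map_pmf (\<lambda>\<omega>. (X \<omega>, Y \<omega>)) P)"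
    and f: "\<And>\<omega>. \<omega> \<in> set_pmf P \<Longrightarrow> Z \<omega> = f (X \<omega>)" and g: "\<And>\<omega>. \<omega> \<in> set_pmf P \<Longrightarrow> Z \<omega> = g (Y \<omega>)"
  shows "shannon_entropy (map_pmf (\<lambda>\<omega>. (X \<omega>, Y \<omega>)) P) + shannon_entropy (map_pmf Z P)
    \<le> shannon_entropy (map_pmf X P) + shannon_entropy (map_pmf Y P)"
proof -
  define pX pY pZ J where p: "pX = map_pmf X P" "pY = map_pmf Y P" "pZ = map_pmf Z P"
    "J = map_pmf (\<lambda>\<omega>. (X \<omega>, Y \<omega>)) P"
  define Q where "Q = bind_pmf pX (\<lambda>a. map_pmf (Pair a) (cond_pmf pY {b. g b = f a}))"
  have pZY: "pZ = map_pmf g pY" unfolding p map_pmf_comp using g by (intro map_pmf_cong) auto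
  have Q: "pmf Q (X \<omega>, Y \<omega>) = pmf pX (X \<omega>) * pmf pY (Y \<omega>) / pmf pZ (Z \<omega>)" if \<omega>: "\<omega> \<in> set_pmf P" for \<omega>
  proof -
    have ne: "set_pmf pY \<inter> {b. g b = f (X \<omega>)} \<noteq> {}"
      using \<omega> f g by (auto simp: p)
    have "pmf Q (X \<omega>, Y \<omega>) =
      (\<integral>a. pmf (map_pmf (Pair a) (cond_pmf pY {b. g b = f a})) (X \<omega>, Y \<omega>) \<partial>measure_pmf pX)"
      unfolding Q_def by (rule pmf_bind)
    also have "\<dots> = (\<Sum>a\<in>{X \<omega>}. pmf pX a *\<^sub>R pmf (map_pmf (Pair a) (cond_pmf pY {b. g b = f a})) (X \<omega>, Y \<omega>))"
      by (rule integral_measure_pmf) (auto simp: pmf_eq_0_set_pmf)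
    also have "\<dots> = pmf pX (X \<omega>) * pmf (cond_pmf pY {b. g b = f (X \<omega>)}) (Y \<omega>)"
      by (simp add: pmf_map_inj' inj_on_def)
    also have "pmf (cond_pmf pY {b. g b = f (X \<omega>)}) (Y \<omega>) =
        pmf pY (Y \<omega>) / measure (measure_pmf pY) {b. g b = f (X \<omega>)}"
      using f[OF \<omega>] g[OF \<omega>] by (simp add: pmf_cond[OF ne])
    also have "measure (measure_pmf pY) {b. g b = f (X \<omega>)} = pmf pZ (Z \<omega>)"
      unfolding pZY pmf_map f[OF \<omega>] by (rule arg_cong[where f="measure (measure_pmf pY)"]) auto
    finally show ?thesis by simp
  qed
  have pos: "0 < pmf pX (X \<omega>)" "0 < pmf pY (Y \<omega>)" "0 < pmf pZ (Z \<omega>)" if "\<omega> \<in> set_pmf P" for \<omega>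
    using that by (auto simp: p intro!: pmf_positive)
  have sQ: "surprisal Q (X \<omega>, Y \<omega>) = surprisal pX (X \<omega>) + surprisal pY (Y \<omega>) - surprisal pZ (Z \<omega>)"
    if \<omega>: "\<omega> \<in> set_pmf P" for \<omega>
    using Q[OF \<omega>] pos[OF \<omega>] by (simp add: surprisal_def log_divide log_mult)
  have int: "integrable (measure_pmf P) (\<lambda>\<omega>. surprisal pX (X \<omega>))" "integrable (measure_pmf P) (\<lambda>\<omega>. surprisal pY (Y \<omega>))"
    "integrable (measure_pmf P) (\<lambda>\<omega>. surprisal pZ (Z \<omega>))"
    using shannon_entropy_map(1) fX fY fZ unfolding p by blast+
  have iQ: "integrable (measure_pmf P) (\<lambda>\<omega>. surprisal Q (X \<omega>, Y \<omega>)) \<longleftrightarrow>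
      integrable (measure_pmf P) (\<lambda>\<omega>. surprisal pX (X \<omega>) + surprisal pY (Y \<omega>) - surprisal pZ (Z \<omega>))"
    using sQ by (intro integrable_cong_AE) (auto simp: AE_measure_pmf_iff)
  \<comment> \<open>By \<open>sQ\<close> the surprisal of \<open>Q\<close> splits into
    single-variable terms, so Gibbs' inequality for \<open>J\<close> against \<open>Q\<close> is the
    claim.\<close>
  have "shannon_entropy J \<le> measure_pmf.expectation J (surprisal Q)"
    unfolding shannon_entropy_eq[OF fXY[folded p]]
  proof (rule pmf_gibbs)
    show "integrable (measure_pmf J) (surprisal J)" using fXY by (simp add: finite_entropy_iff p)
    show "integrable (measure_pmf J) (surprisal Q)" using iQ int by (simp add: p(4))
    show "set_pmf J \<subseteq> set_pmf Q"
    proof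
      fix v assume "v \<in> set_pmf J"
      then obtain \<omega> where "\<omega> \<in> set_pmf P" "v = (X \<omega>, Y \<omega>)" by (auto simp: p)
      then show "v \<in> set_pmf Q" using Q pos by (auto simp: set_pmf_iff less_le)
    qed
  qed
  also have "\<dots> = measure_pmf.expectation P (\<lambda>\<omega>. surprisal Q (X \<omega>, Y \<omega>))" by (simp add: p(4))
  also have "\<dots> = measure_pmf.expectation P (\<lambda>\<omega>. surprisal pX (X \<omega>) + surprisal pY (Y \<omega>) - surprisal pZ (Z \<omega>))"
    using sQ by (intro integral_cong_AE) (auto simp: AE_measure_pmf_iff)
  also have "\<dots> = shannon_entropy pX + shannon_entropy pY - shannon_entropy pZ"
    using int unfolding p
    by (simp add: shannon_entropy_map(2)[OF fX] shannon_entropy_map(2)[OF fY] shannon_entropy_map(2)[OF fZ])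
  finally show ?thesis unfolding p by simp
qed

text \<open>For \<open>x \<le> y\<close> the join is \<open>y\<close>, so the variable at
  \<open>y\<close> determines the one at \<open>x\<close>. Hence the variable at
  \<open>inf x y\<close> is a common function of those at \<open>x\<close> and \<open>y\<close>,
  while the one at \<open>sup x y\<close> is an injective relabelling of their pair.\<close>

lemma entropic_polymatroid:
  fixes h :: "'a::lattice \<Rightarrow> real"
  assumes "entropic h"
  shows "polymatroid h"
proof -
  obtain P :: "('a \<Rightarrow> nat) pmf" where
    det: "\<And>x y. \<exists>f g. \<forall>\<omega>\<in>set_pmf P. \<omega> (sup x y) = f (\<omega> x, \<omega> y) \<and> (\<omega> x, \<omega> y) = g (\<omega> (sup x y))"
    and fin: "\<And>x. finite_entropy (map_pmf (\<lambda>\<omega>. \<omega> x) P)"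
    and h: "\<And>x. h x = shannon_entropy (map_pmf (\<lambda>\<omega>. \<omega> x) P)"
    using assms unfolding entropic_def by blast
  have fn: "\<exists>f. \<forall>\<omega>\<in>set_pmf P. \<omega> x = f (\<omega> y)" if "x \<le> y" for x y
  proof -
    obtain g where "\<forall>\<omega>\<in>set_pmf P. (\<omega> x, \<omega> y) = g (\<omega> (sup x y))" using det by blast
    then have "\<forall>\<omega>\<in>set_pmf P. \<omega> x = (fst \<circ> g) (\<omega> y)"
      using that by (auto simp: sup_absorb2) (metis fst_conv)
    then show ?thesis by blast
  qed
  have mono: "h x \<le> h y" if xy: "x \<le> y" for x y
  proof -
    obtain f where f: "\<forall>\<omega>\<in>set_pmf P. \<omega> x = f (\<omega> y)" using fn[OF xy] by blast
    have "map_pmf (\<lambda>\<omega>. \<omega> x) P = map_pmf f (map_pmf (\<lambda>\<omega>. \<omega> y) P)"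
      unfolding map_pmf_comp using f by (intro map_pmf_cong) auto
    then show ?thesis unfolding h using shannon_entropy_map_le fin by metis
  qed
  have submod: "h (sup x y) + h (inf x y) \<le> h x + h y" for x y
  proof -
    obtain f g where "\<forall>\<omega>\<in>set_pmf P. \<omega> (sup x y) = f (\<omega> x, \<omega> y) \<and> (\<omega> x, \<omega> y) = g (\<omega> (sup x y))"
      using det by blast
    then have f: "f (\<omega> x, \<omega> y) = \<omega> (sup x y)" and g: "g (\<omega> (sup x y)) = (\<omega> x, \<omega> y)"
      if "\<omega> \<in> set_pmf P" for \<omega> using that by metis+
    let ?J = "map_pmf (\<lambda>\<omega>. (\<omega> x, \<omega> y)) P"
    have J: "map_pmf (\<lambda>\<omega>. \<omega> (sup x y)) P = map_pmf f ?J"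
      unfolding map_pmf_comp using f by (intro map_pmf_cong) simp_all
    have inj: "inj_on f (set_pmf ?J)"
      using f g by (intro inj_on_inverseI[of _ g]) auto
    have fJ: "finite_entropy ?J" using finite_entropy_map_inj[OF inj] fin J by metis
    obtain u where u: "\<forall>\<omega>\<in>set_pmf P. \<omega> (inf x y) = u (\<omega> x)" using fn[of "inf x y" x] by auto
    obtain v where v: "\<forall>\<omega>\<in>set_pmf P. \<omega> (inf x y) = v (\<omega> y)" using fn[of "inf x y" y] by auto
    have "shannon_entropy ?J + h (inf x y) \<le> h x + h y"
      unfolding h using u v by (intro shannon_entropy_submodular[of _ _ _ _ u v] fin fJ) auto
    then show ?thesis using shannon_entropy_map_inj[OF inj fJ] unfolding h J by simp
  qed
  have "0 \<le> h x" for x unfolding h by (rule shannon_entropy_nonneg[OF fin])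
  then show ?thesis unfolding polymatroid_def using mono submod by blast
qed

lemma closed_polymatroid: "closed {h :: 'a::lattice \<Rightarrow> real. polymatroid h}"
  unfolding polymatroid_def
  by (intro closed_Collect_conj closed_Collect_all closed_Collect_imp closed_Collect_le open_Collect_const
      continuous_intros continuous_on_product_coordinates)

section \<open>Entropy of random functionals\<close>

lemma factor_throughI:
  assumes "\<And>w w'. w \<in> S \<Longrightarrow> w' \<in> S \<Longrightarrow> B w = B w' \<Longrightarrow> A w = A w'"
  shows "\<exists>f. \<forall>w\<in>S. A w = f (B w)"
proof (intro exI ballI)
  fix w assume w: "w \<in> S"
  let ?w = "SOME w'. w' \<in> S \<and> B w' = B w"
  have "?w \<in> S \<and> B ?w = B w" using w by (intro someI[of "\<lambda>w'. w' \<in> S \<and> B w' = B w"]) simp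
  then show "A w = (\<lambda>b. A (SOME w'. w' \<in> S \<and> B w' = b)) (B w)" using assms[of w ?w] w by simp
qed

lemma finite_entropy_finite: "finite (set_pmf q) \<Longrightarrow> finite_entropy q"
  by (simp add: finite_entropy_def)

text \<open>Mutual determination is expressed by equality of fibres on the sample space. The values
  are then coded injectively in \<open>nat\<close>, which changes no entropy.\<close>

lemma entropicI:
  fixes P :: "'w pmf" and F :: "'a::lattice \<Rightarrow> 'w \<Rightarrow> 'c"
  assumes fin: "finite (set_pmf P)"
    and join: "\<And>x y w w'. w \<in> set_pmf P \<Longrightarrow> w' \<in> set_pmf P \<Longrightarrow>
      F (sup x y) w = F (sup x y) w' \<longleftrightarrow> F x w = F x w' \<and> F y w = F y w'"
  shows "entropic (\<lambda>x. shannon_entropy (map_pmf (F x) P))"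
proof -
  define G where "G x w = to_nat_on (F x ` set_pmf P) (F x w)" for x w
  have inj: "inj_on (to_nat_on (F x ` set_pmf P)) (F x ` set_pmf P)" for x
    using fin by (intro inj_on_to_nat_on) (simp add: countable_finite)
  have G: "G x w = G x w' \<longleftrightarrow> F x w = F x w'" if "w \<in> set_pmf P" "w' \<in> set_pmf P" for x w w'
    using inj_onD[OF inj[of x]] that by (auto simp: G_def)
  have inj': "inj_on (to_nat_on (F x ` set_pmf P)) (set_pmf (map_pmf (F x) P))" for x
    using inj by simp
  define p where "p = map_pmf (\<lambda>w x. G x w) P"
  have m: "map_pmf (\<lambda>\<omega>. \<omega> x) p = map_pmf (to_nat_on (F x ` set_pmf P)) (map_pmf (F x) P)" for x
    unfolding p_def map_pmf_comp by (simp add: G_def)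
  have fe: "finite_entropy (map_pmf (F x) P)" for x using fin by (intro finite_entropy_finite) simp
  have "\<exists>f g. \<forall>\<omega>\<in>set_pmf p. \<omega> (sup x y) = f (\<omega> x, \<omega> y) \<and> (\<omega> x, \<omega> y) = g (\<omega> (sup x y))" for x y
  proof -
    obtain f where f: "\<forall>w\<in>set_pmf P. G (sup x y) w = f (G x w, G y w)"
      using factor_throughI[of "set_pmf P" "\<lambda>w. (G x w, G y w)" "G (sup x y)"] G join by auto
    obtain g where g: "\<forall>w\<in>set_pmf P. (G x w, G y w) = g (G (sup x y) w)"
      using factor_throughI[of "set_pmf P" "G (sup x y)" "\<lambda>w. (G x w, G y w)"] G join by auto
    show ?thesis unfolding p_def using f g by (intro exI[of _ f] exI[of _ g]) simp
  qed
  moreover have "finite_entropy (map_pmf (\<lambda>\<omega>. \<omega> x) p)" for x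
    unfolding m using finite_entropy_map_inj[OF inj'] fe by blast
  moreover have "shannon_entropy (map_pmf (F x) P) = shannon_entropy (map_pmf (\<lambda>\<omega>. \<omega> x) p)" for x
    unfolding m using shannon_entropy_map_inj[OF inj' fe] by simp
  ultimately show ?thesis unfolding entropic_def by blast
qed

text \<open>One term of Gibbs' inequality, for weights that need not be normalised.\<close>

lemma entropy_term_le:
  fixes x y :: real
  assumes "0 < x" "0 < y"
  shows "x * - log 2 x \<le> x * - log 2 y + (y - x) / ln 2"
proof -
  have "ln (y / x) \<le> y / x - 1" using assms by (intro ln_le_minus_one divide_pos_pos)
  then have "x * (ln y - ln x) \<le> x * (y / x - 1)"
    using assms by (intro mult_left_mono) (auto simp: ln_div)
  also have "\<dots> = y - x" using assms by (simp add: field_simps)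
  finally have "x * (ln y - ln x) / ln 2 \<le> (y - x) / ln 2" by (intro divide_right_mono) auto
  moreover have "x * (ln y - ln x) / ln 2 = x * log 2 y - x * log 2 x"
    by (simp add: log_def right_diff_distrib diff_divide_distrib)
  ultimately show ?thesis by simp
qed

text \<open>
  The point mass at \<open>w0\<close> scales entropies by \<open>s\<close>, up to an error that vanishes with \<open>s\<close>.
  This is what turns large entropies into arbitrary real multiples of a dimension vector.
\<close>

definition diluted_uniform :: "real \<Rightarrow> 'w set \<Rightarrow> 'w \<Rightarrow> 'w pmf" where
  "diluted_uniform s \<Omega> w0 = bind_pmf (bernoulli_pmf s) (\<lambda>c. if c then pmf_of_set \<Omega> else return_pmf w0)"

context
  fixes \<Omega> :: "'w set" and w0 :: 'w and s :: real
  assumes fin: "finite \<Omega>" and w0: "w0 \<in> \<Omega>" and s: "0 < s" "s < 1"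
begin

lemma set_pmf_diluted_uniform: "set_pmf (diluted_uniform s \<Omega> w0) = \<Omega>"
proof -
  have ne: "\<Omega> \<noteq> {}" using w0 by auto
  have "set_pmf (bernoulli_pmf s) = UNIV" using s by (rule set_pmf_bernoulli)
  then show ?thesis using w0 fin ne by (auto simp: diluted_uniform_def UNIV_bool)
qed

lemma pmf_map_diluted_uniform:
  "pmf (map_pmf F (diluted_uniform s \<Omega> w0)) v =
    s * (card {w\<in>\<Omega>. F w = v} / card \<Omega>) + (1 - s) * of_bool (F w0 = v)"
proof -
  have ne: "\<Omega> \<noteq> {}" using w0 by auto
  have "\<Omega> \<inter> F -` {v} = {w\<in>\<Omega>. F w = v}" by auto
  then show ?thesis
    using s fin ne unfolding diluted_uniform_def map_bind_pmf pmf_bind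
    by (simp add: pmf_map measure_pmf_of_set indicator_def)
qed

text \<open>Values other than \<open>F w0\<close> have probability at most \<open>1 / r\<close> each
  and total mass at least \<open>s * (1 - 1 / r)\<close>: the lower bound. For the upper bound,
  \<open>F w0\<close> contributes at most \<open>log 2 (1 / (1 - s))\<close>, and the rest, spread
  over at most \<open>k\<close> values, is compared with the constant weight
  \<open>s / k\<close>.\<close>

lemma diluted_uniform_entropy:
  fixes F :: "'w \<Rightarrow> 'c" and r k :: real
  assumes r: "1 \<le> r" "\<And>v. card {w\<in>\<Omega>. F w = v} * r \<le> card \<Omega>" and k: "card (F ` \<Omega>) \<le> k"
  shows "s * (1 - 1 / r) * log 2 r \<le> shannon_entropy (map_pmf F (diluted_uniform s \<Omega> w0))" (is ?lower)
    and "shannon_entropy (map_pmf F (diluted_uniform s \<Omega> w0)) \<le> log 2 (1 / (1 - s)) + s * log 2 (k / s)" (is ?upper)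
proof -
  define q where "q = map_pmf F (diluted_uniform s \<Omega> w0)"
  define A where "A = F ` \<Omega>"
  define a where "a = F w0"
  define c :: "'c \<Rightarrow> real" where "c v = card {w\<in>\<Omega>. F w = v} / card \<Omega>" for v
  have finA: "finite A" and aA: "a \<in> A" using fin w0 by (auto simp: A_def a_def)
  have card_pos: "0 < real (card \<Omega>)" using fin w0 by (auto simp: card_gt_0_iff)
  have q: "pmf q v = s * c v + (1 - s) * of_bool (a = v)" for v
    unfolding q_def c_def a_def by (rule pmf_map_diluted_uniform)
  have setq: "set_pmf q = A" by (simp add: q_def A_def set_pmf_diluted_uniform)
  have ent: "shannon_entropy q = (\<Sum>v\<in>A. pmf q v * surprisal q v)"
    unfolding shannon_entropy_def setq surprisal_def using finA by simp
  have c0: "0 \<le> c v" for v by (simp add: c_def)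
  have cpos: "0 < c v" if "v \<in> A" for v
  proof -
    have "{w\<in>\<Omega>. F w = v} \<noteq> {}" using that by (auto simp: A_def)
    then show ?thesis using fin card_pos by (simp add: c_def card_gt_0_iff)
  qed
  have cr: "c v \<le> 1 / r" for v using r(2)[of v] r(1) card_pos by (simp add: c_def field_simps)
  have c1: "c v \<le> 1" for v
    using cr[of v] r(1) by (meson divide_le_eq_1 order_trans zero_less_one order_less_le_trans)
  have csum: "(\<Sum>v\<in>A. c v) = 1"
  proof -
    have "card \<Omega> = (\<Sum>v\<in>A. card {w\<in>\<Omega>. F w = v})"
      unfolding A_def using sum.image_gen[OF fin, of "\<lambda>_. 1::nat" F] by simp
    then have "real (card \<Omega>) = (\<Sum>v\<in>A. real (card {w\<in>\<Omega>. F w = v}))" by (metis of_nat_sum)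
    then show ?thesis unfolding c_def using card_pos by (simp add: sum_divide_distrib[symmetric])
  qed
  have csum': "(\<Sum>v\<in>A-{a}. c v) = 1 - c a" using csum sum.remove[OF finA aA, of c] by simp
  have split: "shannon_entropy q = pmf q a * surprisal q a + (\<Sum>v\<in>A-{a}. pmf q v * surprisal q v)"
    unfolding ent using sum.remove[OF finA aA] by blast
  have qv: "pmf q v = s * c v" if "v \<in> A - {a}" for v using that q by auto
  have qpos: "0 < pmf q v" if "v \<in> A" for v using that setq by (simp add: pmf_positive)
  have "s * (1 - 1 / r) * log 2 r \<le> s * (1 - c a) * log 2 r"
    using s cr[of a] r(1) by (intro mult_right_mono mult_left_mono) auto
  also have "\<dots> = (\<Sum>v\<in>A-{a}. s * c v * log 2 r)"
    unfolding csum'[symmetric] by (simp add: sum_distrib_left sum_distrib_right)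
  also have "\<dots> \<le> (\<Sum>v\<in>A-{a}. pmf q v * surprisal q v)"
  proof (rule sum_mono)
    fix v assume v: "v \<in> A - {a}"
    have "s * c v \<le> 1 * (1 / r)" using s cr[of v] c0 by (intro mult_mono) auto
    then have "pmf q v \<le> 1 / r" using qv[OF v] by simp
    then have "log 2 (pmf q v) \<le> log 2 (1 / r)" using qpos v by (subst log_le_cancel_iff) (use r in auto)
    then have "log 2 r \<le> surprisal q v" using r(1) by (simp add: surprisal_def log_divide)
    then show "s * c v * log 2 r \<le> pmf q v * surprisal q v"
      unfolding qv[OF v] using s c0 by (intro mult_left_mono) auto
  qed
  also have "\<dots> \<le> shannon_entropy q" unfolding split using surprisal_nonneg[of q a] by simp
  finally show ?lower unfolding q_def .
  have kpos: "1 \<le> k" using k finA aA by (metis A_def card_0_eq empty_iff of_nat_0_less_iff of_nat_1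
        of_nat_le_iff order_trans less_one not_le)
  have qa: "1 - s \<le> pmf q a" using q[of a] s c0[of a] by simp
  have "pmf q a * surprisal q a \<le> 1 * surprisal q a"
    using surprisal_nonneg by (intro mult_right_mono) (auto simp: pmf_le_1)
  also have "\<dots> \<le> log 2 (1 / (1 - s))"
    using qa s by (simp add: surprisal_def log_divide log_le_cancel_iff)
  finally have ba: "pmf q a * surprisal q a \<le> log 2 (1 / (1 - s))" .
  have "(\<Sum>v\<in>A-{a}. pmf q v * surprisal q v) = (\<Sum>v\<in>A-{a}. s * c v * - log 2 (s * c v))"
    using qv by (intro sum.cong) (auto simp: surprisal_def)
  \<comment> \<open>The term of \<open>a\<close> is added with weight \<open>s * c a\<close> instead
    of \<open>pmf q a\<close>, so that the weights sum to \<open>s\<close>.\<close>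
  also have "\<dots> \<le> (\<Sum>v\<in>A. s * c v * - log 2 (s * c v))"
  proof (rule sum_mono2)
    fix v assume "v \<in> A - (A - {a})"
    then have "0 < s * c v" using s cpos aA by auto
    moreover have "s * c v \<le> 1" using mult_mono[of s 1 "c v" 1] s c0[of v] c1[of v] by simp
    ultimately show "0 \<le> s * c v * - log 2 (s * c v)" by (simp add: mult_nonneg_nonpos)
  qed (use finA in auto)
  also have "\<dots> \<le> (\<Sum>v\<in>A. s * c v * log 2 (k / s) + (s / k - s * c v) / ln 2)"
  proof (rule sum_mono)
    fix v assume v: "v \<in> A"
    have "- log 2 (s / k) = log 2 (k / s)" using s kpos by (simp add: log_divide)
    then show "s * c v * - log 2 (s * c v) \<le> s * c v * log 2 (k / s) + (s / k - s * c v) / ln 2"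
      using entropy_term_le[of "s * c v" "s / k"] s cpos[OF v] kpos by simp
  qed
  also have "\<dots> = (\<Sum>v\<in>A. c v) * (s * log 2 (k / s)) + (card A * (s / k) - s * (\<Sum>v\<in>A. c v)) / ln 2"
    by (simp add: sum.distrib sum_divide_distrib[symmetric] sum_subtractf sum_distrib_left sum_distrib_right mult_ac)
  also have "\<dots> \<le> s * log 2 (k / s)"
  proof -
    have "card A * (s / k) \<le> s" using k kpos s unfolding A_def[symmetric] by (simp add: field_simps)
    then show ?thesis unfolding csum by (simp add: divide_nonpos_pos)
  qed
  finally show ?upper using split ba unfolding q_def by linarith
qed

end

section \<open>Rational polynomials and functionals on integer cubes\<close>

text \<open>A concrete space of infinite dimension with the monomials as basis. Rational
  coefficients have common denominators, which later bounds the number of values of a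
  functional.\<close>

interpretation qpoly: vector_space_infinite_field "smult :: rat \<Rightarrow> rat poly \<Rightarrow> rat poly"
proof
  show "infinite (UNIV :: rat set)" by (rule infinite_UNIV_char_0)
qed (auto simp: smult_add_right smult_add_left)

lemma independent_monoms: "qpoly.independent (range (monom 1))"
  unfolding qpoly.independent_explicit_finite_subsets
proof (intro allI impI ballI)
  fix S :: "rat poly set" and u v
  assume S: "S \<subseteq> range (monom 1)" "finite S" and 0: "(\<Sum>v\<in>S. smult (u v) v) = 0" and v: "v \<in> S"
  obtain i where i: "v = monom 1 i" using S v by auto
  have "0 = coeff (\<Sum>v\<in>S. smult (u v) v) i" using 0 by simp
  also have "\<dots> = (\<Sum>w\<in>S. u w * coeff w i)" by (simp add: coeff_sum)
  also have "\<dots> = (\<Sum>w\<in>S. if w = v then u w else 0)"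
    using S(1) i by (intro sum.cong) (auto simp: monom_eq_iff')
  also have "\<dots> = u v" using v S(2) by simp
  finally show "u v = 0" by simp
qed

lemma monom_one_inj: "inj (monom (1::rat))"
  by (auto simp: inj_on_def monom_eq_iff')

text \<open>The vector \<open>w\<close> acts as a linear functional: \<open>monom 1 i\<close> is
  sent to \<open>w i\<close> for \<open>i < n\<close> and to 0 otherwise.\<close>

definition coeff_pairing :: "nat \<Rightarrow> (nat \<Rightarrow> nat) \<Rightarrow> rat poly \<Rightarrow> rat" where
  "coeff_pairing n w v = (\<Sum>i<n. coeff v i * of_nat (w i))"

lemma coeff_pairing_monom: "i < n \<Longrightarrow> coeff_pairing n w (monom 1 i) = of_nat (w i)"
  by (simp add: coeff_pairing_def if_distrib[of "\<lambda>x. x * _"] cong: if_cong)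

lemma subspace_agree: "qpoly.subspace {v. coeff_pairing n w v = coeff_pairing n w' v}"
  unfolding qpoly.subspace_def coeff_pairing_def
  by (auto simp: algebra_simps sum.distrib sum_distrib_left[symmetric])

lemma agree_on_span:
  assumes "\<And>v. v \<in> B \<Longrightarrow> coeff_pairing n w v = coeff_pairing n w' v" "v \<in> qpoly.span B"
  shows "coeff_pairing n w v = coeff_pairing n w' v"
  using qpoly.span_minimal[OF _ subspace_agree, of B n w w'] assms by blast

definition cube :: "nat \<Rightarrow> nat \<Rightarrow> (nat \<Rightarrow> nat) set" where
  "cube n M = {..<n} \<rightarrow>\<^sub>E {..<M}"

lemma finite_cube: "finite (cube n M)"
  by (simp add: cube_def finite_PiE)

lemma card_cube: "card (cube n M) = M ^ n"
  by (simp add: cube_def card_PiE)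

text \<open>A basis of \<open>V\<close> extends by \<open>n - dim V\<close> monomials to a basis of
  the span of all \<open>n\<close> monomials. Once the restriction to \<open>V\<close> is fixed,
  \<open>w\<close> is determined by its coordinates at these monomials.\<close>

lemma card_fibre_le:
  assumes V: "qpoly.fin_dim V" "V \<subseteq> qpoly.span (monom 1 ` {..<n})"
  shows "card {w \<in> cube n M. restrict (coeff_pairing n w) V = f} * M ^ qpoly.dim V \<le> M ^ n"
proof -
  let ?X = "monom (1::rat) ` {..<n}"
  have X: "qpoly.independent ?X" "card ?X = n"
    using qpoly.independent_mono[OF independent_monoms image_mono[OF subset_UNIV]]
      card_image[OF inj_on_subset[OF monom_one_inj subset_UNIV]] by auto
  obtain B where B: "finite B" "qpoly.independent B" "qpoly.span B = V" "card B = qpoly.dim V"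
    using qpoly.fin_dim_basis[OF V(1)] by blast
  obtain B' where B': "B \<subseteq> B'" "B' \<subseteq> B \<union> ?X" "qpoly.independent B'" "B \<union> ?X \<subseteq> qpoly.span B'"
    using qpoly.maximal_independent_subset_extend[of B "B \<union> ?X"] B(2) by blast
  have "B \<subseteq> qpoly.span ?X" using V(2) B(3) qpoly.span_superset by blast
  then have "B' \<subseteq> qpoly.span ?X" using B'(2) qpoly.span_superset[of ?X] by blast
  then have "qpoly.span B' = qpoly.span ?X"
    using B'(4) by (intro subset_antisym qpoly.span_minimal) auto
  then have cB': "card B' = n" using X B'(3) qpoly.dim_eq_card by metis
  have finB': "finite B'" using B'(2) B(1) by (meson finite_UnI finite_imageI finite_lessThan finite_subset)
  define I where "I = {i. i < n \<and> monom 1 i \<in> B' - B}"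
  have "B' - B = monom 1 ` I" using B'(2) by (auto simp: I_def)
  then have "card I = card (B' - B)" using monom_one_inj by (metis card_image inj_on_subset subset_UNIV)
  also have "\<dots> = n - qpoly.dim V" using B'(1) B cB' finB' by (simp add: card_Diff_subset)
  finally have cI: "card I = n - qpoly.dim V" .
  have rn: "qpoly.dim V \<le> n" using B'(1) finB' cB' B(4) card_mono by metis
  let ?f = "{w \<in> cube n M. restrict (coeff_pairing n w) V = f}"
  have "inj_on (\<lambda>w. restrict w I) ?f"
  proof (rule inj_onI)
    fix w w' assume w: "w \<in> ?f" "w' \<in> ?f" and eq: "restrict w I = restrict w' I"
    have r: "restrict (coeff_pairing n w) V = restrict (coeff_pairing n w') V" using w by simp
    have agB: "coeff_pairing n w v = coeff_pairing n w' v" if vB: "v \<in> B'" for v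
    proof (cases "v \<in> B")
      case True
      then have "v \<in> V" using B(3) qpoly.span_base by blast
      then show ?thesis using fun_cong[OF r, of v] by simp
    next
      case False
      then obtain i where i: "v = monom 1 i" "i < n" using vB B'(2) by blast
      then have "i \<in> I" using vB False by (simp add: I_def)
      then have "w i = w' i" using fun_cong[OF eq, of i] by simp
      then show ?thesis using i by (simp add: coeff_pairing_monom)
    qed
    have "w i = w' i" if "i < n" for i
    proof -
      have "monom 1 i \<in> qpoly.span B'" using B'(4) that by auto
      then have "(of_nat (w i) :: rat) = of_nat (w' i)"
        using agree_on_span[OF agB] coeff_pairing_monom[OF that] by metis
      then show ?thesis by simp
    qed
    then show "w = w'" using w by (intro PiE_ext[of w "{..<n}" "\<lambda>_. {..<M}"]) (auto simp: cube_def)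
  qed
  moreover have "(\<lambda>w. restrict w I) ` ?f \<subseteq> I \<rightarrow>\<^sub>E {..<M}"
  proof (rule image_subsetI)
    fix w assume "w \<in> ?f"
    then have w: "w \<in> {..<n} \<rightarrow>\<^sub>E {..<M}" by (simp add: cube_def)
    have "w i \<in> {..<M}" if "i \<in> I" for i using PiE_mem[OF w, of i] that by (simp add: I_def)
    then show "restrict w I \<in> I \<rightarrow>\<^sub>E {..<M}" by (simp add: restrict_PiE_iff)
  qed
  moreover have finI: "finite I" by (simp add: I_def)
  ultimately have "card ?f \<le> card (I \<rightarrow>\<^sub>E {..<M})" by (intro card_inj_on_le) (auto intro: finite_PiE)
  also have "\<dots> = M ^ (n - qpoly.dim V)" using finI cI by (simp add: card_PiE)
  finally have "card ?f * M ^ qpoly.dim V \<le> M ^ (n - qpoly.dim V) * M ^ qpoly.dim V" by simp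
  also have "\<dots> = M ^ n" using rn by (simp add: power_add[symmetric])
  finally show ?thesis .
qed

lemma common_denominator:
  fixes c :: "nat \<Rightarrow> rat"
  shows "\<exists>D::int. D > 0 \<and> (\<forall>i<n. of_int D * c i \<in> \<int>)"
proof (induction n)
  case 0
  show ?case by (intro exI[of _ 1]) simp
next
  case (Suc n)
  then obtain D :: int where D: "D > 0" "\<forall>i<n. of_int D * c i \<in> \<int>" by blast
  obtain a d where ad: "quotient_of (c n) = (a, d)" by fastforce
  have d: "d > 0" "c n = of_int a / of_int d" using quotient_of_denom_pos[OF ad] quotient_of_div[OF ad] by auto
  have "of_int (D * d) * c i \<in> \<int>" if "i < Suc n" for i
  proof (cases "i = n")
    case True
    have "of_int (D * d) * c i = (of_int (D * a) :: rat)" using d True by simp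
    then show ?thesis by (metis Ints_of_int)
  next
    case False
    then have "of_int D * c i \<in> \<int>" using D that by simp
    then have "of_int d * (of_int D * c i) \<in> \<int>" using Ints_mult[OF Ints_of_int[of d]] by blast
    moreover have "of_int (D * d) * c i = of_int d * (of_int D * c i)" by simp
    ultimately show ?thesis by metis
  qed
  then show ?case using D d by (intro exI[of _ "D * d"]) simp
qed

text \<open>After clearing denominators the values are integers of modulus at most
  \<open>L * M\<close>, so there are at most \<open>2 * L * M + 1\<close> of them. The factor
  \<open>C\<close> does not depend on \<open>M\<close>.\<close>

lemma card_values_le:
  "\<exists>C\<ge>1. \<forall>M\<ge>1. card ((\<lambda>w. coeff_pairing n w v) ` cube n M) \<le> C * M"
proof -
  obtain D :: int where D: "D > 0" "\<forall>i<n. of_int D * coeff v i \<in> \<int>"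
    using common_denominator by blast
  then have "\<forall>i. \<exists>k::int. i < n \<longrightarrow> of_int D * coeff v i = of_int k" by (metis Ints_cases)
  then obtain k :: "nat \<Rightarrow> int" where k: "\<And>i. i < n \<Longrightarrow> of_int D * coeff v i = of_int (k i)" by metis
  define L where "L = (\<Sum>i<n. \<bar>k i\<bar>)"
  have L0: "0 \<le> L" by (simp add: L_def sum_nonneg)
  have "card ((\<lambda>w. coeff_pairing n w v) ` cube n M) \<le> nat (2 * L + 1) * M" if M: "M \<ge> 1" for M
  proof -
    have "(\<lambda>w. coeff_pairing n w v) ` cube n M \<subseteq> (\<lambda>z. of_int z / of_int D) ` {- L * M .. L * M}"
    proof
      fix z assume "z \<in> (\<lambda>w. coeff_pairing n w v) ` cube n M"
      then obtain w where w: "w \<in> cube n M" "z = coeff_pairing n w v" by auto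
      define y where "y = (\<Sum>i<n. k i * int (w i))"
      have "of_int D * z = (\<Sum>i<n. (of_int D * coeff v i) * of_nat (w i))"
        by (simp add: w coeff_pairing_def sum_distrib_left mult_ac)
      also have "\<dots> = of_int y" using k by (simp add: y_def)
      finally have "z = of_int y / of_int D" using D by (simp add: field_simps)
      moreover have "\<bar>y\<bar> \<le> L * M"
      proof -
        have "\<bar>y\<bar> \<le> (\<Sum>i<n. \<bar>k i * int (w i)\<bar>)" unfolding y_def by (rule sum_abs)
        also have "\<dots> \<le> (\<Sum>i<n. \<bar>k i\<bar> * int M)"
        proof (rule sum_mono)
          fix i assume "i \<in> {..<n}"
          then have "w i < M" using w(1) by (auto simp: cube_def)
          then show "\<bar>k i * int (w i)\<bar> \<le> \<bar>k i\<bar> * int M" by (simp add: abs_mult mult_left_mono)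
        qed
        finally show ?thesis by (simp add: L_def sum_distrib_right)
      qed
      ultimately show "z \<in> (\<lambda>z. of_int z / of_int D) ` {- L * M .. L * M}" by (intro image_eqI[of _ _ y]) auto
    qed
    then have "card ((\<lambda>w. coeff_pairing n w v) ` cube n M) \<le> card {- L * int M .. L * int M}"
      by (meson card_image_le card_mono finite_atLeastAtMost_int finite_imageI order_trans)
    also have "\<dots> = nat (2 * L * M + 1)" by simp
    also have "\<dots> \<le> nat ((2 * L + 1) * M)" using M L0 by (intro nat_mono) (simp add: algebra_simps)
    also have "\<dots> = nat (2 * L + 1) * M" using L0 by (simp add: nat_mult_distrib)
    finally show ?thesis .
  qed
  then show ?thesis using L0 by (intro exI[of _ "nat (2 * L + 1)"]) auto
qed

text \<open>A functional on \<open>V\<close> is determined by its values on a basis, one factor for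
  each basis vector.\<close>

lemma card_restrictions_le:
  assumes "qpoly.fin_dim V"
  shows "\<exists>C\<ge>1. \<forall>M\<ge>1. card ((\<lambda>w. restrict (coeff_pairing n w) V) ` cube n M) \<le> (C * M) ^ qpoly.dim V"
proof -
  obtain B where B: "finite B" "qpoly.independent B" "qpoly.span B = V" "card B = qpoly.dim V"
    using qpoly.fin_dim_basis[OF assms] by blast
  obtain c where c: "\<And>v. c v \<ge> 1" "\<And>v M. M \<ge> 1 \<Longrightarrow> card ((\<lambda>w. coeff_pairing n w v) ` cube n M) \<le> c v * M"
    using card_values_le[of n] by metis
  \<comment> \<open>The summand 1 keeps \<open>C\<close> positive when the basis is empty.\<close>
  define C where "C = 1 + (\<Sum>v\<in>B. c v)"
  have cC: "c v \<le> C" if "v \<in> B" for v using member_le_sum[OF that, of c] B(1) by (simp add: C_def)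
  have "card ((\<lambda>w. restrict (coeff_pairing n w) V) ` cube n M) \<le> (C * M) ^ qpoly.dim V" if M: "M \<ge> 1" for M
  proof -
    let ?A = "(\<lambda>w. restrict (coeff_pairing n w) V) ` cube n M"
    let ?E = "\<lambda>v. (\<lambda>w. coeff_pairing n w v) ` cube n M"
    have BV: "B \<subseteq> V" using B(3) qpoly.span_superset by blast
    have "inj_on (\<lambda>g. restrict g B) ?A"
    proof (rule inj_onI)
      fix g g' assume g: "g \<in> ?A" "g' \<in> ?A" and eq: "restrict g B = restrict g' B"
      obtain w w' where w: "g = restrict (coeff_pairing n w) V" "g' = restrict (coeff_pairing n w') V"
        using g by auto
      have "coeff_pairing n w v = coeff_pairing n w' v" if "v \<in> B" for v
        using fun_cong[OF eq, of v] subsetD[OF BV that] that w by simp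
      then have "coeff_pairing n w v = coeff_pairing n w' v" if "v \<in> V" for v
        using agree_on_span[of B n w w' v] B(3) that by blast
      then show "g = g'" unfolding w by (intro restrict_ext) auto
    qed
    moreover have "(\<lambda>g. restrict g B) ` ?A \<subseteq> PiE B ?E"
    proof (rule image_subsetI)
      fix g assume "g \<in> ?A"
      then obtain w where w: "w \<in> cube n M" "g = restrict (coeff_pairing n w) V" by blast
      have "g v \<in> ?E v" if "v \<in> B" for v
        using w BV that by (intro image_eqI[of _ _ w]) auto
      then show "restrict g B \<in> PiE B ?E" by (simp add: restrict_PiE_iff)
    qed
    moreover have "finite (PiE B ?E)" using B(1) finite_cube by (intro finite_PiE) auto
    ultimately have "card ?A \<le> card (PiE B ?E)" by (rule card_inj_on_le)
    also have "\<dots> = (\<Prod>v\<in>B. card (?E v))" using B(1) by (rule card_PiE)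
    also have "\<dots> \<le> (\<Prod>v\<in>B. C * M)"
      using c(2)[OF M] cC by (intro prod_mono) (meson le_trans mult_le_mono1 zero_le)
    also have "\<dots> = (C * M) ^ qpoly.dim V" using B(4) by simp
    finally show ?thesis .
  qed
  then show ?thesis by (intro exI[of _ C]) (auto simp: C_def)
qed

lemma fin_dim_subset_monoms:
  assumes "qpoly.fin_dim V"
  obtains n where "V \<subseteq> qpoly.span (monom 1 ` {..<n})"
proof -
  obtain B where B: "finite B" "V = qpoly.span B" using assms by (auto simp: qpoly.fin_dim_def)
  define n where "n = Suc (Max (insert 0 (degree ` B)))"
  have "v \<in> qpoly.span (monom 1 ` {..<n})" if v: "v \<in> B" for v
  proof -
    have "degree v < n" unfolding n_def using B(1) v by (simp add: less_Suc_eq_le)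
    have "v = (\<Sum>i\<le>degree v. smult (coeff v i) (monom 1 i))"
      by (simp add: smult_monom poly_as_sum_of_monoms)
    also have "\<dots> \<in> qpoly.span (monom 1 ` {..<n})"
      using \<open>degree v < n\<close> by (intro qpoly.span_sum qpoly.span_scale qpoly.span_base) auto
    finally show ?thesis .
  qed
  then have "V \<subseteq> qpoly.span (monom 1 ` {..<n})" unfolding B(2) by (intro qpoly.span_minimal) auto
  then show thesis by (rule that)
qed

section \<open>Approximation of polymatroids\<close>

lemma tendsto_fun_coordinatewise:
  fixes f :: "'b \<Rightarrow> 'a \<Rightarrow> 'c::topological_space"
  assumes "\<And>x. ((\<lambda>n. f n x) \<longlongrightarrow> l x) F"
  shows "(f \<longlongrightarrow> l) F"
proof -
  have "limitin (product_topology (\<lambda>x. euclidean) UNIV) f l F"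
    unfolding limitin_componentwise using assms by auto
  then show ?thesis unfolding euclidean_product_topology limitin_canonical_iff .
qed

text \<open>\<open>s M\<close> is chosen so that \<open>s M * log 2 M = 1 / N\<close>; both bounds
  then have the main term \<open>r / N\<close>. The errors vanish because \<open>s\<close>,
  \<open>s * log 2 C\<close> and \<open>s * log 2 (1 / s)\<close> tend to 0.\<close>

lemma entropy_bounds_tendsto:
  fixes N :: real and C r :: nat
  assumes N: "0 < N" and C: "1 \<le> C"
  defines "s \<equiv> \<lambda>M::nat. 1 / (N * log 2 (real M))"
  shows "eventually (\<lambda>M. 0 < s M \<and> s M < 1) sequentially"
    and "((\<lambda>M. s M * (1 - 1 / real (M ^ r)) * log 2 (real (M ^ r))) \<longlongrightarrow> r / N) sequentially"
    and "((\<lambda>M. log 2 (1 / (1 - s M)) + s M * log 2 (real ((C * M) ^ r) / s M)) \<longlongrightarrow> r / N) sequentially"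
proof -
  have s0: "s \<longlonglongrightarrow> 0" unfolding s_def using N by real_asymp
  have spos: "eventually (\<lambda>M. 0 < s M) sequentially" unfolding s_def using N by real_asymp
  show ev: "eventually (\<lambda>M. 0 < s M \<and> s M < 1) sequentially"
    using spos order_tendstoD(2)[OF s0, of 1] by (auto elim: eventually_elim2)
  have lg: "eventually (\<lambda>M. s M * log 2 (real M) = 1 / N) sequentially"
    using eventually_gt_at_top[of 1]
  proof eventually_elim
    case (elim M)
    then have "0 < log 2 (real M)" by simp
    then show ?case using N by (simp add: s_def)
  qed
  show "((\<lambda>M. s M * (1 - 1 / real (M ^ r)) * log 2 (real (M ^ r))) \<longlongrightarrow> r / N) sequentially"
  \<comment> \<open>For \<open>r = 0\<close> the factor \<open>1 - 1 / M ^ r\<close> is 0 and does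
    not tend to 1, but then the limit is 0 as well.\<close>
  proof (cases "r = 0")
    case False
    have "(\<lambda>M. (1 - inverse (real M ^ r)) * (r / N)) \<longlonglongrightarrow> (1 - 0) * (r / N)"
      using False by (intro tendsto_intros filterlim_compose[OF tendsto_inverse_0_at_top]
          filterlim_pow_at_top filterlim_real_sequentially tendsto_inverse_0_at_top) auto
    moreover have "eventually (\<lambda>M. (1 - inverse (real M ^ r)) * (r / N) =
        s M * (1 - 1 / real (M ^ r)) * log 2 (real (M ^ r))) sequentially"
      using lg eventually_gt_at_top[of 1]
    proof eventually_elim
      case (elim M)
      have "s M * (1 - 1 / real (M ^ r)) * log 2 (real (M ^ r)) = (1 - 1 / real (M ^ r)) * (r * (s M * log 2 (real M)))"
        using elim(2) by (simp add: log_nat_power)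
      then show ?case unfolding elim(1) by (simp add: inverse_eq_divide)
    qed
    ultimately show ?thesis using Lim_transform_eventually by fastforce
  qed simp
  have at_right: "filterlim s (at_right 0) sequentially"
    using s0 spos by (auto simp: filterlim_at elim: eventually_mono)
  have "((\<lambda>x. log 2 (1 / (1 - x)) + x * (r * log 2 C) + x * log 2 (1 / x)) \<longlongrightarrow> 0) (at_right (0::real))"
    by real_asymp
  then have "(\<lambda>M. log 2 (1 / (1 - s M)) + s M * (r * log 2 C) + s M * log 2 (1 / s M)) \<longlonglongrightarrow> 0"
    using at_right by (rule filterlim_compose)
  then have "(\<lambda>M. log 2 (1 / (1 - s M)) + s M * (r * log 2 C) + s M * log 2 (1 / s M) + r / N) \<longlonglongrightarrow> 0 + r / N"
    by (intro tendsto_intros)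
  moreover have "eventually (\<lambda>M. log 2 (1 / (1 - s M)) + s M * (r * log 2 C) + s M * log 2 (1 / s M) + r / N =
      log 2 (1 / (1 - s M)) + s M * log 2 (real ((C * M) ^ r) / s M)) sequentially"
    using lg ev eventually_gt_at_top[of 1]
  proof eventually_elim
    case (elim M)
    have "log 2 (real ((C * M) ^ r) / s M) = r * (log 2 C + log 2 M) + log 2 (1 / s M)"
      using elim C by (simp add: log_divide log_nat_power log_mult)
    then have "s M * log 2 (real ((C * M) ^ r) / s M) = s M * (r * log 2 C) + r * (s M * log 2 M) + s M * log 2 (1 / s M)"
      by (simp add: algebra_simps)
    then show ?case unfolding elim(1) by simp
  qed
  ultimately show "((\<lambda>M. log 2 (1 / (1 - s M)) + s M * log 2 (real ((C * M) ^ r) / s M)) \<longlongrightarrow> r / N) sequentially"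
    using Lim_transform_eventually by fastforce
qed

text \<open>Functionals agree on the space of a join exactly when they agree on both summands, so
  restrictions of one random functional satisfy the join condition of \<open>entropic\<close>. The
  two entropy bounds squeeze each coordinate to its limit.\<close>

lemma representation_in_closure:
  fixes V :: "'a::{finite,lattice} \<Rightarrow> rat poly set"
  assumes fd: "\<And>x. qpoly.fin_dim (V x)" and join: "\<And>x y. V (sup x y) = qpoly.span (V x \<union> V y)"
    and N: "0 < (N::real)"
  shows "(\<lambda>x. qpoly.dim (V x) / N) \<in> closure {h. entropic h}"
proof -
  \<comment> \<open>Every \<open>V x\<close> lies in the space of the top element, so a single
    \<open>n\<close> bounds all degrees.\<close>
  define top' :: 'a where "top' = Sup_fin UNIV"
  have "V x \<subseteq> V top'" for x
  proof -
    have "sup x top' = top'" unfolding top'_def by (simp add: sup_absorb2 Sup_fin.coboundedI)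
    then show ?thesis using join[of x top'] qpoly.span_superset[of "V x \<union> V top'"] by auto
  qed
  moreover obtain n where "V top' \<subseteq> qpoly.span (monom 1 ` {..<n})"
    using fin_dim_subset_monoms[OF fd] by blast
  ultimately have n: "V x \<subseteq> qpoly.span (monom 1 ` {..<n})" for x by blast
  define F where "F x w = restrict (coeff_pairing n w) (V x)" for x w
  have Feq: "F x w = F x w' \<longleftrightarrow> (\<forall>v\<in>V x. coeff_pairing n w v = coeff_pairing n w' v)" for x w w'
    unfolding F_def by (metis restrict_apply' restrict_ext)
  have Fjoin: "F (sup x y) w = F (sup x y) w' \<longleftrightarrow> F x w = F x w' \<and> F y w = F y w'" for x y w w'
    unfolding Feq join using agree_on_span[of "V x \<union> V y" n w w'] qpoly.span_superset[of "V x \<union> V y"] by blast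
  obtain C where C: "\<And>x. C x \<ge> 1"
    "\<And>x M. M \<ge> 1 \<Longrightarrow> card (F x ` cube n M) \<le> (C x * M) ^ qpoly.dim (V x)"
    using card_restrictions_le[OF fd] unfolding F_def by metis
  define s where "s M = 1 / (N * log 2 (real M))" for M :: nat
  \<comment> \<open>The zero functional, which lies in every cube with
    \<open>M \<ge> 1\<close>.\<close>
  define w0 :: "nat \<Rightarrow> nat" where "w0 = restrict (\<lambda>_. 0) {..<n}"
  define H where "H M x = shannon_entropy (map_pmf (F x) (diluted_uniform (s M) (cube n M) w0))" for M x
  note lims = entropy_bounds_tendsto[OF N, folded s_def]
  have w0: "w0 \<in> cube n M" if "M \<ge> 1" for M using that by (auto simp: w0_def cube_def)
  have good: "eventually (\<lambda>M. 0 < s M \<and> s M < 1 \<and> M \<ge> 1) sequentially"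
    using lims(1)[OF le_refl] eventually_ge_at_top[of 1] by eventually_elim auto
  have ent: "eventually (\<lambda>M. H M \<in> closure {h. entropic h}) sequentially"
    using good
  proof eventually_elim
    case (elim M)
    have sp: "set_pmf (diluted_uniform (s M) (cube n M) w0) = cube n M"
      using set_pmf_diluted_uniform[OF finite_cube w0] elim by blast
    have "entropic (\<lambda>x. shannon_entropy (map_pmf (F x) (diluted_uniform (s M) (cube n M) w0)))"
      by (rule entropicI) (simp_all add: sp finite_cube Fjoin)
    moreover have "H M = (\<lambda>x. shannon_entropy (map_pmf (F x) (diluted_uniform (s M) (cube n M) w0)))"
      by (rule ext) (simp add: H_def)
    ultimately have "H M \<in> {h. entropic h}" by simp
    then show ?case by (rule subsetD[OF closure_subset])
  qed
  have "(\<lambda>M. H M x) \<longlonglongrightarrow> qpoly.dim (V x) / N" for x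
  proof -
    let ?r = "qpoly.dim (V x)"
    have fib: "real (card {w \<in> cube n M. F x w = v}) * real (M ^ ?r) \<le> real (card (cube n M))" for M v
      unfolding F_def card_cube of_nat_mult[symmetric] of_nat_le_iff by (rule card_fibre_le[OF fd n])
    have lo: "eventually (\<lambda>M. s M * (1 - 1 / real (M ^ ?r)) * log 2 (real (M ^ ?r)) \<le> H M x) sequentially"
      using good
    proof eventually_elim
      case (elim M)
      show ?case unfolding H_def
        by (rule diluted_uniform_entropy(1)[OF finite_cube w0, where k = "real (card (F x ` cube n M))"])
          (use elim fib in auto)
    qed
    have hi: "eventually (\<lambda>M. H M x \<le> log 2 (1 / (1 - s M)) + s M * log 2 (real ((C x * M) ^ ?r) / s M)) sequentially"
      using good
    proof eventually_elim
      case (elim M)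
      show ?case unfolding H_def
        by (rule diluted_uniform_entropy(2)[OF finite_cube w0, where r = "real (M ^ ?r)"])
          (use elim fib C(2)[of M x] in \<open>auto simp flip: of_nat_power of_nat_mult\<close>)
    qed
    show ?thesis
      by (rule tendsto_sandwich[OF lo hi lims(2)[OF le_refl, of ?r] lims(3)[OF C(1)[of x], of ?r]])
  qed
  then have "(H \<longlongrightarrow> (\<lambda>x. qpoly.dim (V x) / N)) sequentially"
    by (rule tendsto_fun_coordinatewise)
  then show ?thesis using Lim_in_closed_set[OF closed_closure ent] by simp
qed

section \<open>Rounding a polymatroid function to integers\<close>

text \<open>Cardinalities of a union and an intersection; strictness comes from
  \<open>m = inf x y\<close>, which is above neither \<open>x\<close> nor \<open>y\<close> but is
  above \<open>inf x y\<close>.\<close>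

lemma card_not_below_strictly_submodular:
  fixes x y :: "'a::{finite,lattice}"
  assumes "\<not> x \<le> y" "\<not> y \<le> x"
  shows "card {m. \<not> sup x y \<le> m} + card {m. \<not> inf x y \<le> m} < card {m. \<not> x \<le> m} + card {m. \<not> y \<le> m}"
proof -
  let ?A = "{m. \<not> x \<le> m}" and ?B = "{m. \<not> y \<le> m}"
  have "{m. \<not> sup x y \<le> m} = ?A \<union> ?B" by auto
  then have "card {m. \<not> sup x y \<le> m} = card (?A \<union> ?B)" by simp
  moreover have "{m. \<not> inf x y \<le> m} \<subset> ?A \<inter> ?B"
  proof
    show "{m. \<not> inf x y \<le> m} \<subseteq> ?A \<inter> ?B" by (auto intro: le_infI1 le_infI2)
    have "inf x y \<in> ?A \<inter> ?B" using assms by simp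
    then show "{m. \<not> inf x y \<le> m} \<noteq> ?A \<inter> ?B" by blast
  qed
  then have "card {m. \<not> inf x y \<le> m} < card (?A \<inter> ?B)" by (simp add: psubset_card_mono)
  moreover have "card (?A \<union> ?B) + card (?A \<inter> ?B) = card ?A + card ?B" by (rule card_Un_Int[OF finite finite, symmetric])
  ultimately show ?thesis by linarith
qed

text \<open>Rounding down loses less than 2 in the submodular inequality; a strictly submodular integer correction restores it.\<close>

definition integer_approx :: "('a::{finite,lattice} \<Rightarrow> real) \<Rightarrow> nat \<Rightarrow> 'a \<Rightarrow> nat" where
  "integer_approx h N x = nat \<lfloor>real N * h x\<rfloor> + 2 * card {m. \<not> x \<le> m}"

lemma integer_approx_mono:
  assumes "polymatroid h" "x \<le> y"
  shows "integer_approx h N x \<le> integer_approx h N y"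
proof -
  have "h x \<le> h y" using assms by (simp add: polymatroid_def)
  then have "\<lfloor>real N * h x\<rfloor> \<le> \<lfloor>real N * h y\<rfloor>" by (intro floor_mono mult_left_mono) auto
  moreover have "card {m. \<not> x \<le> m} \<le> card {m. \<not> y \<le> m}"
    using assms(2) by (intro card_mono) (auto intro: order_trans)
  ultimately show ?thesis unfolding integer_approx_def by (simp add: add_mono nat_mono)
qed

lemma nat_floor_bounds:
  fixes a :: real
  assumes "0 \<le> a"
  shows "a - 1 < real (nat \<lfloor>a\<rfloor>)" "real (nat \<lfloor>a\<rfloor>) \<le> a"
  using assms by linarith+

lemma integer_approx_submodular:
  assumes h: "polymatroid h"
  shows "integer_approx h N (sup x y) + integer_approx h N (inf x y) \<le> integer_approx h N x + integer_approx h N y"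
proof (cases "x \<le> y \<or> y \<le> x")
  case True
  then show ?thesis by (auto simp: sup_absorb1 sup_absorb2 inf_absorb1 inf_absorb2)
next
  case False
  have h0: "0 \<le> real N * h z" for z using h by (simp add: polymatroid_def)
  have "real N * (h (sup x y) + h (inf x y)) \<le> real N * (h x + h y)"
    using h by (intro mult_left_mono) (auto simp: polymatroid_def)
  then have "real (nat \<lfloor>real N * h (sup x y)\<rfloor> + nat \<lfloor>real N * h (inf x y)\<rfloor>)
      < real (nat \<lfloor>real N * h x\<rfloor> + nat \<lfloor>real N * h y\<rfloor> + 2)"
    using nat_floor_bounds[OF h0[of x]] nat_floor_bounds[OF h0[of y]]
      nat_floor_bounds[OF h0[of "sup x y"]] nat_floor_bounds[OF h0[of "inf x y"]]
    unfolding of_nat_add distrib_left of_nat_numeral by linarith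
  then have "nat \<lfloor>real N * h (sup x y)\<rfloor> + nat \<lfloor>real N * h (inf x y)\<rfloor>
      < nat \<lfloor>real N * h x\<rfloor> + nat \<lfloor>real N * h y\<rfloor> + 2" by (simp only: of_nat_less_iff)
  \<comment> \<open>Between integers the floors fail by at most 1, while the doubled strict
    inequality of cardinalities gains at least 2.\<close>
  then show ?thesis
    using card_not_below_strictly_submodular[of x y] False unfolding integer_approx_def by simp
qed

lemma integer_approx_tendsto:
  assumes "polymatroid h"
  shows "(\<lambda>N. integer_approx h (Suc N) x / Suc N) \<longlonglongrightarrow> h x"
proof -
  define k where "k = 2 * card {m. \<not> x \<le> m}"
  have hN: "0 \<le> real (Suc N) * h x" for N using assms by (simp add: polymatroid_def)
  have lim: "(\<lambda>N. h x + c / real (Suc N)) \<longlonglongrightarrow> h x" for c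
    using tendsto_add[OF tendsto_const LIMSEQ_Suc[OF lim_const_over_n], of "h x" c] by simp
  show ?thesis
  proof (rule tendsto_sandwich[OF _ _ lim[of "-1"] lim[of "real k"]])
    show "\<forall>\<^sub>F N in sequentially. h x + - 1 / real (Suc N) \<le> integer_approx h (Suc N) x / Suc N"
    proof (rule always_eventually, rule allI)
      fix N
      have "real (Suc N) * h x - 1 \<le> integer_approx h (Suc N) x"
        using nat_floor_bounds(1)[OF hN[of N]] unfolding integer_approx_def of_nat_add by linarith
      then have "(real (Suc N) * h x - 1) / Suc N \<le> integer_approx h (Suc N) x / Suc N"
        by (rule divide_right_mono) simp
      then show "h x + - 1 / real (Suc N) \<le> integer_approx h (Suc N) x / Suc N"
        by (simp add: diff_divide_distrib del: of_nat_Suc)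
    qed
    show "\<forall>\<^sub>F N in sequentially. integer_approx h (Suc N) x / Suc N \<le> h x + real k / real (Suc N)"
    proof (rule always_eventually, rule allI)
      fix N
      have "integer_approx h (Suc N) x \<le> real (Suc N) * h x + k"
        using nat_floor_bounds(2)[OF hN[of N]] unfolding integer_approx_def k_def of_nat_add by linarith
      then have "integer_approx h (Suc N) x / Suc N \<le> (real (Suc N) * h x + k) / Suc N"
        by (rule divide_right_mono) simp
      then show "integer_approx h (Suc N) x / Suc N \<le> h x + real k / real (Suc N)"
        by (simp add: add_divide_distrib del: of_nat_Suc)
    qed
  qed
qed

theorem theorem17:
  assumes "modular_lattice TYPE('a::{finite,lattice})"
      and "planar_lattice TYPE('a)"
  shows "shannon_lattice TYPE('a)"
  unfolding shannon_lattice_def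
proof (rule subset_antisym)
  show "closure {h. entropic h} \<subseteq> {h :: 'a \<Rightarrow> real. polymatroid h}"
    by (intro closure_minimal closed_polymatroid) (auto intro: entropic_polymatroid)
  show "{h :: 'a \<Rightarrow> real. polymatroid h} \<subseteq> closure {h. entropic h}"
  proof
    fix h :: "'a \<Rightarrow> real" assume "h \<in> {h. polymatroid h}"
    then have h: "polymatroid h" by simp
    obtain R :: "'a \<Rightarrow> 'a \<Rightarrow> bool" where R: "conjugate_order R"
      using planar_lattice_conjugate_order[OF assms(2)] .
    \<comment> \<open>\<open>Suc N\<close> keeps the denominator positive.\<close>
    have "(\<lambda>x. integer_approx h (Suc N) x / real (Suc N)) \<in> closure {h. entropic h}" for N
    proof -
      have inf: "infinite (range (monom (1::rat)))"
        using monom_one_inj by (simp add: finite_image_iff)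
      have bt: "Inf_fin UNIV \<le> x" "x \<le> Sup_fin UNIV" for x :: 'a
        by (auto intro: Inf_fin.coboundedI Sup_fin.coboundedI)
      obtain V where V: "\<forall>x\<in>UNIV. qpoly.fin_dim (V x) \<and> qpoly.dim (V x) = integer_approx h (Suc N) x"
        "\<forall>x\<in>UNIV. \<forall>y\<in>UNIV. V (sup x y) = qpoly.span (V x \<union> V y)"
        using qpoly.modular_linear_representation[OF inf independent_monoms assms(1) R bt
            integer_approx_mono[OF h] integer_approx_submodular[OF h], of UNIV "Suc N"]
        by (auto simp: sublattice_def)
      show ?thesis using representation_in_closure[of V "real (Suc N)"] V by simp
    qed
    moreover have "(\<lambda>N x. integer_approx h (Suc N) x / real (Suc N)) \<longlonglongrightarrow> h"
      by (rule tendsto_fun_coordinatewise) (rule integer_approx_tendsto[OF h])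
    ultimately show "h \<in> closure {h. entropic h}"
      by (intro Lim_in_closed_set[OF closed_closure, of "\<lambda>N x. integer_approx h (Suc N) x / real (Suc N)"]) auto
  qed
qed

end
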